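(* Let $x^1,\dots,x^n\in\mathbb{R}^m$, $d_{ij}=\|x^i-x^j\|_2^2$, and let $\{\Gamma_1,\Gamma_2\}$ be a partition of $[n]$ with $|\Gamma_1|\le|\Gamma_2|$. If Algorithm Certify, run on the numbers $\gamma_{ij}$ associated with this partition, terminates with success $=$ true, then the partition matrix $$\bar X=\frac{1}{|\Gamma_1|}\mathbf{1}_{\Gamma_1}\mathbf{1}_{\Gamma_1}^T+\frac{1}{|\Gamma_2|}\mathbf{1}_{\Gamma_2}\mathbf{1}_{\Gamma_2}^T$$ is an optimal solution of the linear program (LP2). Moreover, Algorithm Certify runs in $O(n^3)$ operations.
   Context: $[n]:=\{1,\dots,n\}$. A partition $\{\Gamma_1,\Gamma_2\}$ of $[n]$ consists of two non-empty disjoint subsets with union $[n]$. $\mathbf{1}_{\Gamma}\in\mathbb{R}^n$ is the indicator vector of $\Gamma\subseteq[n]$. (LP2) is the linear program in the entries of a symmetric matrix $X\in\mathbb{R}^{n\times n}$ ($X_{ij}=X_{ji}$): minimize $\sum_{i,j\in[n]}d_{ij}X_{ij}$ subject to $\mathrm{Tr}(X)=2$; $\sum_{j=1}^nX_{ij}=1$ for all $i\in[n]$; $X_{ij}+X_{ik}\le X_{ii}+X_{jk}$ for all pairwise distinct $i,j,k\in[n]$ with $j<k$; $X_{ij}\ge0$ for all $1\le i<j\le n$. For $i\in\Gamma_l$, $l\in\{1,2\}$: $d^{\rm in}_i:=\frac{1}{|\Gamma_l|}\sum_{j\in\Gamma_l}d_{ij}$. Let $r_l:=\frac{2|\Gamma_l|}{|\Gamma_1|+|\Gamma_2|}$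 for $l\in\{1,2\}$ and $$\eta:=\frac{r_2}{2}\Bigg(\Big(1-\frac{r_1}{r_2}\Big)\max_{k\in\Gamma_1}d^{\rm in}_k+\Big(1-\frac{r_2}{r_1}\Big)\min_{k\in\Gamma_2}d^{\rm in}_k+\frac{r_1}{r_2}\cdot\frac{1}{|\Gamma_1|}\sum_{k\in\Gamma_1}d^{\rm in}_k+\frac{r_2}{r_1}\cdot\frac{1}{|\Gamma_2|}\sum_{k\in\Gamma_2}d^{\rm in}_k\Bigg).$$ Define $$\gamma_{ij}:=\frac{2}{|\Gamma_2|}\sum_{k\in\Gamma_2}\min\{r_2d_{ik}+d^{\rm in}_j,\,r_2d_{jk}+d^{\rm in}_i\}-2d_{ij}-2\eta,\quad i<j\in\Gamma_1,$$ $$\gamma_{ij}:=\frac{2}{|\Gamma_1|}\sum_{k\in\Gamma_1}\min\{r_1d_{ik}+d^{\rm in}_j,\,r_1d_{jk}+d^{\rm in}_i\}-2d_{ij}-2\frac{r_1}{r_2}\eta,\quad i<j\in\Gamma_2,$$ and $\gamma_{ji}:=\gamma_{ij}$. Algorithm Certify. Input: $\gamma_{ij}$ for all $i<j\in\Gamma_l$, $l\in\{1,2\}$. Output: a Boolean success. (Real arithmetic; $\bar r_{ij}=\bar r_{ji}$ denote the same variable.) 1. Initialize $\bar\lambda_{ijk}=\bar\lambda_{jik}=\bar\lambda_{kij}=0$ for all distinct $i,j,k$ in the same $\Gamma_l$, $\bar r_{ij}=\gamma_{ij}$ for all distinct $i,j$ in the same $\Gamma_l$, and $\mathcal{N}=\{(i,j):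 i<j,\ i,j\in\Gamma_l \text{ for some } l\in\{1,2\},\ \bar r_{ij}<0\}$. If $\mathcal N=\emptyset$, the algorithm terminates with success $=$ true. 2. While $\mathcal{N}\ne\emptyset$: set success $=$ false and select some $(i,j)\in\mathcal{N}$, with $i,j\in\Gamma_l$. For each $k\in\Gamma_l\setminus\{i,j\}$: let $\omega=\min\{-\bar r_{ij},\bar r_{ik},\bar r_{jk}\}$; if $\omega\le0$, go to the next $k$; otherwise update $\bar r_{ik}\leftarrow\bar r_{ik}-\omega$, $\bar r_{jk}\leftarrow\bar r_{jk}-\omega$, $\bar r_{ij}\leftarrow\bar r_{ij}+\omega$, $\bar\lambda_{kij}\leftarrow\bar\lambda_{kij}+\omega$, $\bar\lambda_{kji}\leftarrow\bar\lambda_{kji}+\omega$, and if now $\bar r_{ij}\ge0$, set success $=$ true, remove $(i,j)$ from $\mathcal{N}$, and exit the loop over $k$. If after the loop over $k$ success $=$ false, return (terminate with success $=$ false). *)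

theory Defs
  imports
    "HOL-Analysis.Analysis"
    "HOL-Library.Landau_Symbols"
    "HOL-Library.While_Combinator"
begin

definition bipartition :: "nat \<Rightarrow> nat set \<Rightarrow> nat set \<Rightarrow> bool" where
  "bipartition n \<Gamma>1 \<Gamma>2 \<longleftrightarrow>
     \<Gamma>1 \<noteq> {} \<and> \<Gamma>2 \<noteq> {} \<and> \<Gamma>1 \<inter> \<Gamma>2 = {} \<and> \<Gamma>1 \<union> \<Gamma>2 = {1..n}"

definition sq_dist :: "(nat \<Rightarrow> real ^ 'm) \<Rightarrow> nat \<Rightarrow> nat \<Rightarrow> real" where
  "sq_dist x i j = (norm (x i - x j))\<^sup>2"


text \<open>An \<open>n \<times> n\<close> matrix is a function \<open>nat \<Rightarrow> nat \<Rightarrow> real\<close> of which only the entries with both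
  indices in \<open>{1..n}\<close> matter.\<close>

definition lp2_objective :: "nat \<Rightarrow> (nat \<Rightarrow> nat \<Rightarrow> real) \<Rightarrow> (nat \<Rightarrow> nat \<Rightarrow> real) \<Rightarrow> real" where
  "lp2_objective n d X = (\<Sum>i\<in>{1..n}. \<Sum>j\<in>{1..n}. d i j * X i j)"

definition lp2_feasible :: "nat \<Rightarrow> (nat \<Rightarrow> nat \<Rightarrow> real) \<Rightarrow> bool" where
  "lp2_feasible n X \<longleftrightarrow>
     (\<forall>i\<in>{1..n}. \<forall>j\<in>{1..n}. X i j = X j i) \<and>
     (\<Sum>i\<in>{1..n}. X i i) = 2 \<and>
     (\<forall>i\<in>{1..n}. (\<Sum>j\<in>{1..n}. X i j) = 1) \<and>
     (\<forall>i\<in>{1..n}. \<forall>j\<in>{1..n}. \<forall>k\<in>{1..n}.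
        i \<noteq> j \<and> i \<noteq> k \<and> j < k \<longrightarrow> X i j + X i k \<le> X i i + X j k) \<and>
     (\<forall>i\<in>{1..n}. \<forall>j\<in>{1..n}. i < j \<longrightarrow> 0 \<le> X i j)"

definition lp2_optimal :: "nat \<Rightarrow> (nat \<Rightarrow> nat \<Rightarrow> real) \<Rightarrow> (nat \<Rightarrow> nat \<Rightarrow> real) \<Rightarrow> bool" where
  "lp2_optimal n d X \<longleftrightarrow> is_arg_min (lp2_objective n d) (lp2_feasible n) X"

definition partition_matrix :: "nat set \<Rightarrow> nat set \<Rightarrow> nat \<Rightarrow> nat \<Rightarrow> real" where
  "partition_matrix \<Gamma>1 \<Gamma>2 i j =
     1 / real (card \<Gamma>1) * (indicator \<Gamma>1 i * indicator \<Gamma>1 j) +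
     1 / real (card \<Gamma>2) * (indicator \<Gamma>2 i * indicator \<Gamma>2 j)"


text \<open>\<open>d_in d \<Gamma> i\<close> is only meant for \<open>i \<in> \<Gamma>\<close>.\<close>

definition d_in :: "(nat \<Rightarrow> nat \<Rightarrow> real) \<Rightarrow> nat set \<Rightarrow> nat \<Rightarrow> real" where
  "d_in d \<Gamma> i = 1 / real (card \<Gamma>) * (\<Sum>j\<in>\<Gamma>. d i j)"

definition cluster_ratio :: "nat set \<Rightarrow> nat set \<Rightarrow> nat set \<Rightarrow> real" where
  "cluster_ratio \<Gamma>1 \<Gamma>2 \<Gamma> = 2 * real (card \<Gamma>) / (real (card \<Gamma>1) + real (card \<Gamma>2))"

definition eta :: "(nat \<Rightarrow> nat \<Rightarrow> real) \<Rightarrow> nat set \<Rightarrow> nat set \<Rightarrow> real" where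
  "eta d \<Gamma>1 \<Gamma>2 = (let r1 = cluster_ratio \<Gamma>1 \<Gamma>2 \<Gamma>1; r2 = cluster_ratio \<Gamma>1 \<Gamma>2 \<Gamma>2 in
     r2 / 2 *
       ((1 - r1 / r2) * (MAX k\<in>\<Gamma>1. d_in d \<Gamma>1 k) +
        (1 - r2 / r1) * (MIN k\<in>\<Gamma>2. d_in d \<Gamma>2 k) +
        r1 / r2 * (1 / real (card \<Gamma>1)) * (\<Sum>k\<in>\<Gamma>1. d_in d \<Gamma>1 k) +
        r2 / r1 * (1 / real (card \<Gamma>2)) * (\<Sum>k\<in>\<Gamma>2. d_in d \<Gamma>2 k)))"

text \<open>\<open>gamma_less\<close> is only meant for \<open>i < j\<close> in the same cluster; \<open>0\<close> is a dummy value.\<close>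

definition gamma_less :: "(nat \<Rightarrow> nat \<Rightarrow> real) \<Rightarrow> nat set \<Rightarrow> nat set \<Rightarrow> nat \<Rightarrow> nat \<Rightarrow> real" where
  "gamma_less d \<Gamma>1 \<Gamma>2 i j = (let r1 = cluster_ratio \<Gamma>1 \<Gamma>2 \<Gamma>1; r2 = cluster_ratio \<Gamma>1 \<Gamma>2 \<Gamma>2;
       \<eta> = eta d \<Gamma>1 \<Gamma>2 in
     if i \<in> \<Gamma>1 \<and> j \<in> \<Gamma>1 then
       2 / real (card \<Gamma>2) *
         (\<Sum>k\<in>\<Gamma>2. min (r2 * d i k + d_in d \<Gamma>1 j) (r2 * d j k + d_in d \<Gamma>1 i))
       - 2 * d i j - 2 * \<eta>
     else if i \<in> \<Gamma>2 \<and> j \<in> \<Gamma>2 then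
       2 / real (card \<Gamma>1) *
         (\<Sum>k\<in>\<Gamma>1. min (r1 * d i k + d_in d \<Gamma>2 j) (r1 * d j k + d_in d \<Gamma>2 i))
       - 2 * d i j - 2 * (r1 / r2) * \<eta>
     else 0)"

definition gamma :: "(nat \<Rightarrow> nat \<Rightarrow> real) \<Rightarrow> nat set \<Rightarrow> nat set \<Rightarrow> nat \<Rightarrow> nat \<Rightarrow> real" where
  "gamma d \<Gamma>1 \<Gamma>2 i j =
     (if i < j then gamma_less d \<Gamma>1 \<Gamma>2 i j else gamma_less d \<Gamma>1 \<Gamma>2 j i)"


text \<open>
  Cost model for Algorithm Certify (real RAM): one operation for each arithmetic operation,
  comparison, assignment to a scalar variable or array entry, for each insertion into, removal
  from, selection from and emptiness test of \<open>pending\<close>, and for the control of each loop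
  iteration. The field \<open>ops\<close> is the number of operations performed so far. Where the branches of
  a conditional differ by a constant, the more expensive one may be charged.

  The set \<open>\<N>\<close> of the algorithm is \<open>pending\<close>. The array \<open>rbar\<close> is indexed by unordered pairs
  \<open>{i, j}\<close>, as \<open>(i, j)\<close> and \<open>(j, i)\<close> denote the same variable. The flag \<open>returned\<close> records
  that the return statement has been executed.\<close>

record cert_state =
  rbar :: "nat set \<Rightarrow> real"
  lam :: "nat \<times> nat \<times> nat \<Rightarrow> real"
  pending :: "(nat \<times> nat) set"
  success :: bool
  returned :: bool
  ops :: nat

definition tick :: "nat \<Rightarrow> cert_state \<Rightarrow> cert_state" where
  "tick c s = s\<lparr>ops := ops s + c\<rparr>"

text \<open>The memory is arbitrary before it is initialized.\<close>

definition blank_state :: cert_state where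
  "blank_state = \<lparr>rbar = (\<lambda>_. undefined), lam = (\<lambda>_. undefined), pending = {},
     success = False, returned = False, ops = 0\<rparr>"

text \<open>Per index triple: 1 for loop control, 3 for index comparisons, 1 for the assignment. Per
  index pair: 1 for loop control and 1 for each comparison, assignment or insertion.\<close>

definition init_lam :: "nat set \<Rightarrow> cert_state \<Rightarrow> cert_state" where
  "init_lam \<Gamma> = (let L = sorted_list_of_set \<Gamma> in
     fold (\<lambda>(i, j, k) s. tick 5
         (if distinct [i, j, k] then s\<lparr>lam := (lam s)((i, j, k) := 0)\<rparr> else s))
       (List.product L (List.product L L)))"

definition init_rbar :: "(nat \<Rightarrow> nat \<Rightarrow> real) \<Rightarrow> nat set \<Rightarrow> cert_state \<Rightarrow> cert_state" where
  "init_rbar g \<Gamma> = (let L = sorted_list_of_set \<Gamma> in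
     fold (\<lambda>(i, j) s. tick 3
         (if i < j then s\<lparr>rbar := (rbar s)({i, j} := g i j)\<rparr> else s))
       (List.product L L))"

definition init_pending :: "nat set \<Rightarrow> cert_state \<Rightarrow> cert_state" where
  "init_pending \<Gamma> = (let L = sorted_list_of_set \<Gamma> in
     fold (\<lambda>(i, j) s. tick 4
         (if i < j \<and> rbar s {i, j} < 0 then s\<lparr>pending := insert (i, j) (pending s)\<rparr> else s))
       (List.product L L))"

text \<open>4 = setting \<open>pending\<close> to \<open>{}\<close>, testing it for emptiness, setting \<open>success\<close>, and the last
  test of the while condition, which is not part of any iteration.\<close>

definition certify_init ::
    "nat set \<Rightarrow> nat set \<Rightarrow> (nat \<Rightarrow> nat \<Rightarrow> real) \<Rightarrow> cert_state" where
  "certify_init \<Gamma>1 \<Gamma>2 g =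
     (let s = init_lam \<Gamma>2 (init_lam \<Gamma>1 blank_state);
          s = init_rbar g \<Gamma>2 (init_rbar g \<Gamma>1 s);
          s = init_pending \<Gamma>2 (init_pending \<Gamma>1 s)
      in tick 4 (if pending s = {} then s\<lparr>success := True\<rparr> else s))"

text \<open>8 = loop control, the tests \<open>k \<noteq> i\<close> and \<open>k \<noteq> j\<close>, the negation, two comparisons for the
  minimum, the assignment to \<open>\<omega>\<close> and the test \<open>\<omega> \<le> 0\<close>; 11 = five updates (each an arithmetic
  operation and an assignment) and the test \<open>0 \<le> rbar\<close>; 3 = setting \<open>success\<close>, removal from
  \<open>pending\<close>, and exit.\<close>

definition certify_k :: "nat \<Rightarrow> nat \<Rightarrow> nat \<Rightarrow> cert_state \<Rightarrow> cert_state" where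
  "certify_k i j k s =
     (let r = rbar s; \<omega> = Min {- r {i, j}, r {i, k}, r {j, k}}; s = tick 8 s in
      if \<omega> \<le> 0 then s
      else
        let s = tick 11 (s
              \<lparr>rbar := (rbar s)
                 ({i, k} := rbar s {i, k} - \<omega>,
                  {j, k} := rbar s {j, k} - \<omega>,
                  {i, j} := rbar s {i, j} + \<omega>),
               lam := (lam s)
                 ((k, i, j) := lam s (k, i, j) + \<omega>,
                  (k, j, i) := lam s (k, j, i) + \<omega>)\<rparr>)
        in if rbar s {i, j} \<ge> 0
           then tick 3 (s\<lparr>success := True, pending := pending s - {(i, j)}\<rparr>)
           else s)"

fun certify_k_loop :: "nat \<Rightarrow> nat \<Rightarrow> nat list \<Rightarrow> cert_state \<Rightarrow> cert_state" where
  "certify_k_loop i j [] s = s"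
| "certify_k_loop i j (k # ks) s =
     (let s = certify_k i j k s in if success s then s else certify_k_loop i j ks s)"

text \<open>
  The algorithm leaves open which pair of \<open>pending\<close> is selected and in which order the
  indices \<open>k\<close> are visited. The two functions of a schedule resolve these choices; they may
  depend on the whole current state. As \<open>pending\<close> changes in every iteration of the while loop
  that does not return, every execution of the algorithm arises from some schedule.\<close>

definition schedule ::
    "nat set \<Rightarrow> nat set \<Rightarrow> (cert_state \<Rightarrow> nat \<times> nat) \<Rightarrow>
     (cert_state \<Rightarrow> nat \<Rightarrow> nat \<Rightarrow> nat list) \<Rightarrow> bool" where
  "schedule \<Gamma>1 \<Gamma>2 sel visit \<longleftrightarrow>
     (\<forall>s. pending s \<noteq> {} \<longrightarrow> sel s \<in> pending s) \<and>
     (\<forall>s. \<forall>\<Gamma>\<in>{\<Gamma>1, \<Gamma>2}. \<forall>i\<in>\<Gamma>. \<forall>j\<in>\<Gamma>. i < j \<longrightarrow>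
        distinct (visit s i j) \<and> set (visit s i j) = \<Gamma> - {i, j})"

lemma schedule_exists:
  assumes "bipartition n \<Gamma>1 \<Gamma>2"
  shows "\<exists>sel visit. schedule \<Gamma>1 \<Gamma>2 sel visit"
proof -
  have "finite (\<Gamma>1 \<union> \<Gamma>2)" and disj: "\<Gamma>1 \<inter> \<Gamma>2 = {}"
    using assms by (simp_all add: bipartition_def)
  then have "finite \<Gamma>1" "finite \<Gamma>2"
    by simp_all
  with disj have "schedule \<Gamma>1 \<Gamma>2 (\<lambda>s. SOME p. p \<in> pending s)
      (\<lambda>s i j. sorted_list_of_set ((if i \<in> \<Gamma>1 then \<Gamma>1 else \<Gamma>2) - {i, j}))"
    unfolding schedule_def by (auto simp: some_in_eq)
  then show ?thesis by blast
qed

text \<open>12 = test of the while condition, resetting \<open>success\<close>, selection of \<open>(i, j)\<close>, determining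
  the cluster of \<open>i\<close>, the test of \<open>success\<close> after the loop over \<open>k\<close>, the return, and
  6 for skipping \<open>i\<close> and \<open>j\<close> in the loop over \<open>k\<close>.\<close>

definition certify_body ::
    "(cert_state \<Rightarrow> nat \<times> nat) \<Rightarrow> (cert_state \<Rightarrow> nat \<Rightarrow> nat \<Rightarrow> nat list) \<Rightarrow>
     cert_state \<Rightarrow> cert_state" where
  "certify_body sel visit s =
     (let s = tick 12 (s\<lparr>success := False\<rparr>);
          (i, j) = sel s;
          s = certify_k_loop i j (visit s i j) s
      in if success s then s else s\<lparr>returned := True\<rparr>)"

text \<open>The result is \<open>None\<close> iff the while loop does not terminate; otherwise it is the final state,
  whose field \<open>success\<close> is the output.\<close>

definition certify ::
    "nat set \<Rightarrow> nat set \<Rightarrow> (nat \<Rightarrow> nat \<Rightarrow> real) \<Rightarrow>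
     (cert_state \<Rightarrow> nat \<times> nat) \<Rightarrow> (cert_state \<Rightarrow> nat \<Rightarrow> nat \<Rightarrow> nat list) \<Rightarrow>
     cert_state option" where
  "certify \<Gamma>1 \<Gamma>2 g sel visit =
     while_option (\<lambda>s. pending s \<noteq> {} \<and> \<not> returned s) (certify_body sel visit)
       (certify_init \<Gamma>1 \<Gamma>2 g)"

end

theory Submission
  imports Defs
begin

text \<open>The optimality part is linear programming duality in disguise. For a feasible matrix \<open>X\<close> put
  \<open>\<rho> i j = (X i i + X j j) / 2 - X i j\<close>. In these terms the inequalities
  \<open>X i j + X i k \<le> X i i + X j k\<close> are exactly the triangle inequalities of \<open>\<rho>\<close>, so \<open>\<rho>\<close> is a
  semimetric, and the row and trace equations say that \<open>\<Sum>j. \<rho> i j = n * X i i / 2\<close> and that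
  \<open>\<rho>\<close> has total mass \<open>n\<close>. The diagonal of \<open>X\<close> is thus determined by \<open>\<rho>\<close>, and the objective becomes
  a linear function of \<open>\<rho>\<close>. The partition matrix is the semimetric that vanishes inside the clusters
  and is constant across them.

  The numbers \<open>\<gamma>\<close> are what is left inside the clusters after all weight across the clusters has been
  cancelled: half the sum of \<open>\<gamma> i j * \<rho> i j\<close> over the ordered pairs inside the clusters is at most
  the excess of the objective of \<open>X\<close> over that of the partition matrix (\<open>gamma_gap_sum_le\<close>). Two
  kinds of inequalities achieve the cancellation. Since \<open>\<rho> i k\<close> and \<open>\<rho> j k\<close> differ by at most
  \<open>\<rho> i j\<close>, the weights \<open>u i\<close> of the \<open>\<rho> i k\<close>, for \<open>i\<close> in one cluster and a fixed \<open>k\<close> in the other,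
  may be replaced by their average at a cost proportional to the sum of
  \<open>\<bar>u i - u j\<bar> * \<rho> i j\<close> (\<open>sum_mult_le_average\<close>); this is where the minima in \<open>\<gamma>\<close>
  come from. The remaining weights depend only on the cluster averages \<open>d_in\<close>, and they are removed by
  \<open>X i k \<ge> 0\<close>, summed over a row and weighted by the distance of \<open>d_in\<close> to its maximum or minimum
  (\<open>weighted_cross_gap_le\<close>); this is where the extrema in \<open>\<eta>\<close> come from.

  Algorithm Certify finally shows that the sum of \<open>\<gamma> i j * \<rho> i j\<close> is nonnegative. Each update
  lowers the sum of \<open>rbar {i, j} * \<rho> i j\<close> by \<open>2 * \<omega> * (\<rho> i k + \<rho> k j - \<rho> i j)\<close>, which is
  nonnegative by the triangle inequality. When the algorithm succeeds,
  all \<open>rbar {i, j}\<close> are nonnegative, and so was the initial sum (\<open>certify_success_imp_nonneg\<close>).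

  For the running time, each round of the while loop costs \<open>O(n)\<close> and either removes a pair from the
  at most \<open>n\<^sup>2\<close> pending ones for good or is the last round (\<open>certify_ops_le\<close>).\<close>

section \<open>The semimetric of a feasible matrix\<close>

text \<open>The definition averages \<open>X i j\<close> and \<open>X j i\<close>, so that symmetry holds for every matrix; on feasible
  matrices it agrees with the shorter formula in \<open>gap_eq\<close>.\<close>

definition gap :: "(nat \<Rightarrow> nat \<Rightarrow> real) \<Rightarrow> nat \<Rightarrow> nat \<Rightarrow> real" where
  "gap X i j = (X i i + X j j - X i j - X j i) / 2"

lemma gap_self [simp]: "gap X i i = 0"
  by (simp add: gap_def)

lemma gap_commute: "gap X i j = gap X j i"
  by (simp add: gap_def)

lemma gap_eq:
  assumes "lp2_feasible n X" "i \<in> {1..n}" "j \<in> {1..n}"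
  shows "gap X i j = (X i i + X j j) / 2 - X i j"
  using assms unfolding gap_def lp2_feasible_def by (simp add: field_simps)

lemma gap_triangle:
  assumes X: "lp2_feasible n X" and mem: "i \<in> {1..n}" "j \<in> {1..n}" "k \<in> {1..n}"
    and "i \<noteq> j" "i \<noteq> k" "j \<noteq> k"
  shows "gap X j k \<le> gap X j i + gap X i k"
proof -
  have "X i j + X i k \<le> X i i + X j k"
  proof (cases "j < k")
    case True
    then show ?thesis using X mem \<open>i \<noteq> j\<close> \<open>i \<noteq> k\<close> unfolding lp2_feasible_def by blast
  next
    case False
    then have "k < j" using \<open>j \<noteq> k\<close> by simp
    then have "X i k + X i j \<le> X i i + X k j"
      using X mem \<open>i \<noteq> j\<close> \<open>i \<noteq> k\<close> unfolding lp2_feasible_def by blast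
    moreover have "X k j = X j k" using X mem unfolding lp2_feasible_def by blast
    ultimately show ?thesis by simp
  qed
  moreover have "X j i = X i j" using X mem unfolding lp2_feasible_def by blast
  ultimately show ?thesis
    using mem by (simp add: gap_eq[OF X] field_simps)
qed

text \<open>Adding the triangle inequalities for \<open>i, k\<close> and for \<open>j, k\<close> cancels everything but
  \<open>2 * gap X i j\<close>. The third point \<open>k\<close> is what makes triangle constraints available: for \<open>n = 2\<close> there
  are none.\<close>

lemma gap_nonneg:
  assumes "lp2_feasible n X" "i \<in> {1..n}" "j \<in> {1..n}" "k \<in> {1..n}"
    and "k \<noteq> i" "k \<noteq> j"
  shows "0 \<le> gap X i j"
proof (cases "i = j")
  case False
  then have "gap X i k \<le> gap X i j + gap X j k" "gap X j k \<le> gap X j i + gap X i k"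
    using assms by (auto intro!: gap_triangle)
  then show ?thesis
    using gap_commute[of X i j] by simp
qed simp

text \<open>This is how the semimetric determines the diagonal, and with it the whole matrix.\<close>

lemma sum_gap:
  assumes X: "lp2_feasible n X" and i: "i \<in> {1..n}"
  shows "(\<Sum>j\<in>{1..n}. gap X i j) = real n * X i i / 2"
proof -
  have "(\<Sum>j\<in>{1..n}. gap X i j) = (\<Sum>j\<in>{1..n}. X i i / 2 + X j j / 2 - X i j)"
    by (intro sum.cong refl) (simp add: gap_eq[OF X i] add_divide_distrib)
  also have "\<dots> = real n * X i i / 2 + (\<Sum>j\<in>{1..n}. X j j) / 2 - (\<Sum>j\<in>{1..n}. X i j)"
    by (simp add: sum.distrib sum_subtractf sum_divide_distrib)
  moreover have "(\<Sum>j\<in>{1..n}. X j j) = 2" "(\<Sum>j\<in>{1..n}. X i j) = 1"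
    using X i unfolding lp2_feasible_def by blast+
  ultimately show ?thesis by simp
qed

section \<open>Averaging weights across a semimetric\<close>

text \<open>The sum of \<open>(u i - u j) * (p i - p j)\<close> over all pairs is the difference between the two sides
  without \<open>t\<close>, as in the proof of Chebyshev's sum inequality; each summand is estimated by the
  Lipschitz bound on \<open>p\<close>.\<close>

lemma sum_mult_le_average:
  fixes u p :: "'a \<Rightarrow> real" and t :: "'a \<Rightarrow> 'a \<Rightarrow> real"
  assumes fin: "finite A" "A \<noteq> {}"
    and lip: "\<And>i j. i \<in> A \<Longrightarrow> j \<in> A \<Longrightarrow> \<bar>p i - p j\<bar> \<le> t i j"
  shows "2 * real (card A) * (\<Sum>i\<in>A. u i * p i) \<le>
    2 * (\<Sum>i\<in>A. u i) * (\<Sum>i\<in>A. p i) + (\<Sum>i\<in>A. \<Sum>j\<in>A. \<bar>u i - u j\<bar> * t i j)"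
proof -
  have "(\<Sum>i\<in>A. \<Sum>j\<in>A. (u i - u j) * (p i - p j))
      = (\<Sum>i\<in>A. \<Sum>j\<in>A. u i * p i + u j * p j - u i * p j - u j * p i)"
    by (simp add: algebra_simps)
  also have "\<dots> = 2 * real (card A) * (\<Sum>i\<in>A. u i * p i) - 2 * (\<Sum>i\<in>A. u i) * (\<Sum>i\<in>A. p i)"
    by (simp add: sum.distrib sum_subtractf sum_product sum_distrib_left[symmetric]
        sum.swap[of "\<lambda>i j. u j * p i"])
  finally have "2 * real (card A) * (\<Sum>i\<in>A. u i * p i)
      = 2 * (\<Sum>i\<in>A. u i) * (\<Sum>i\<in>A. p i) + (\<Sum>i\<in>A. \<Sum>j\<in>A. (u i - u j) * (p i - p j))"
    by simp
  also have "(\<Sum>i\<in>A. \<Sum>j\<in>A. (u i - u j) * (p i - p j)) \<le> (\<Sum>i\<in>A. \<Sum>j\<in>A. \<bar>u i - u j\<bar> * t i j)"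
  proof (intro sum_mono)
    fix i j assume "i \<in> A" "j \<in> A"
    have "(u i - u j) * (p i - p j) \<le> \<bar>u i - u j\<bar> * \<bar>p i - p j\<bar>"
      by (metis abs_ge_self abs_mult)
    also have "\<dots> \<le> \<bar>u i - u j\<bar> * t i j"
      by (intro mult_left_mono lip \<open>i \<in> A\<close> \<open>j \<in> A\<close>) simp
    finally show "(u i - u j) * (p i - p j) \<le> \<bar>u i - u j\<bar> * t i j" .
  qed
  finally show ?thesis by simp
qed

text \<open>The averaging inequality is applied, for each \<open>k\<close> in \<open>B\<close>, to the weights
  \<open>c * d i k - \<alpha> i\<close> of the distances \<open>\<rho> i k\<close>. Because
  \<open>2 * min x y = x + y - \<bar>x - y\<bar>\<close>, its error term is precisely what the minima on the left-hand
  side contribute besides linear terms. With \<open>\<alpha> = d_in d A\<close> and suitable \<open>c\<close> and \<open>h\<close>, the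
  left-hand side is half the sum of \<open>\<gamma> i j * \<rho> i j\<close> over the pairs inside \<open>A\<close>.\<close>

lemma cluster_transport:
  fixes d \<rho> :: "'a \<Rightarrow> 'a \<Rightarrow> real" and \<alpha> :: "'a \<Rightarrow> real"
  assumes A: "finite A" "A \<noteq> {}" and B: "finite B" "B \<noteq> {}"
    and comm: "\<And>i j. \<rho> i j = \<rho> j i"
    and lip: "\<And>i j k. i \<in> A \<Longrightarrow> j \<in> A \<Longrightarrow> k \<in> B \<Longrightarrow> \<bar>\<rho> i k - \<rho> j k\<bar> \<le> \<rho> i j"
  shows "(\<Sum>i\<in>A. \<Sum>j\<in>A. (2 / real (card B) * (\<Sum>k\<in>B. min (c * d i k + \<alpha> j) (c * d j k + \<alpha> i))
            - 2 * d i j - 2 * h) * \<rho> i j) / 2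
    \<le> c / real (card B) * ((\<Sum>i\<in>A. (\<Sum>k\<in>B. d i k) * (\<Sum>j\<in>A. \<rho> i j))
                          + (\<Sum>k\<in>B. (\<Sum>i\<in>A. d i k) * (\<Sum>i\<in>A. \<rho> i k)))
      + (\<Sum>i\<in>A. \<alpha> i * (\<Sum>j\<in>A. \<rho> i j))
      - (\<Sum>i\<in>A. \<alpha> i) / real (card B) * (\<Sum>i\<in>A. \<Sum>k\<in>B. \<rho> i k)
      - (\<Sum>i\<in>A. \<Sum>j\<in>A. d i j * \<rho> i j)
      - h * (\<Sum>i\<in>A. \<Sum>j\<in>A. \<rho> i j)
      - real (card A) / real (card B) *
          (c * (\<Sum>i\<in>A. \<Sum>k\<in>B. d i k * \<rho> i k) - (\<Sum>i\<in>A. \<alpha> i * (\<Sum>k\<in>B. \<rho> i k)))"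
    (is "?G / 2 \<le> _")
proof -
  define a b where "a = real (card A)" and "b = real (card B)"
  have pos: "a > 0" "b > 0"
    using A B by (auto simp: a_def b_def card_gt_0_iff)
  define u where "u k i = c * d i k - \<alpha> i" for k i
  define U where "U = (\<Sum>k\<in>B. \<Sum>i\<in>A. \<Sum>j\<in>A. \<bar>u k i - u k j\<bar> * \<rho> i j)"
  define SAP where "SAP = (\<Sum>i\<in>A. (\<Sum>k\<in>B. d i k) * (\<Sum>j\<in>A. \<rho> i j))"
  define SaP where "SaP = (\<Sum>i\<in>A. \<alpha> i * (\<Sum>j\<in>A. \<rho> i j))"
  define dAA where "dAA = (\<Sum>i\<in>A. \<Sum>j\<in>A. d i j * \<rho> i j)"
  define P where "P = (\<Sum>i\<in>A. \<Sum>j\<in>A. \<rho> i j)"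
  have min_eq: "2 * (\<Sum>k\<in>B. min (c * d i k + \<alpha> j) (c * d j k + \<alpha> i))
      = c * (\<Sum>k\<in>B. d i k) + c * (\<Sum>k\<in>B. d j k) + b * \<alpha> i + b * \<alpha> j - (\<Sum>k\<in>B. \<bar>u k i - u k j\<bar>)" for i j
  proof -
    have "2 * min (c * d i k + \<alpha> j) (c * d j k + \<alpha> i)
        = c * d i k + c * d j k + \<alpha> i + \<alpha> j - \<bar>u k i - u k j\<bar>" for k
      by (simp add: u_def min_def abs_if)
    then show ?thesis
      by (simp add: sum_distrib_left sum.distrib sum_subtractf b_def)
  qed
  have swapP: "(\<Sum>i\<in>A. \<Sum>j\<in>A. f j * \<rho> i j) = (\<Sum>i\<in>A. f i * (\<Sum>j\<in>A. \<rho> i j))" for f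
    by (subst sum.swap) (simp add: sum_distrib_left comm)
  have "b * ?G = (\<Sum>i\<in>A. \<Sum>j\<in>A. (2 * (\<Sum>k\<in>B. min (c * d i k + \<alpha> j) (c * d j k + \<alpha> i))
            - 2 * b * d i j - 2 * b * h) * \<rho> i j)"
    using pos by (simp add: sum_distrib_left b_def[symmetric] field_simps)
  also have "\<dots> = (\<Sum>i\<in>A. \<Sum>j\<in>A. c * ((\<Sum>k\<in>B. d i k) * \<rho> i j) + c * ((\<Sum>k\<in>B. d j k) * \<rho> i j)
       + b * (\<alpha> i * \<rho> i j) + b * (\<alpha> j * \<rho> i j) - (\<Sum>k\<in>B. \<bar>u k i - u k j\<bar>) * \<rho> i j
       - 2 * b * (d i j * \<rho> i j) - 2 * b * h * \<rho> i j)"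
    unfolding min_eq by (simp add: algebra_simps)
  also have "\<dots> = c * SAP + c * SAP + b * SaP + b * SaP
       - (\<Sum>i\<in>A. \<Sum>j\<in>A. (\<Sum>k\<in>B. \<bar>u k i - u k j\<bar>) * \<rho> i j) - 2 * b * dAA - 2 * b * h * P"
    unfolding sum.distrib sum_subtractf sum_distrib_left[symmetric] swapP SAP_def SaP_def dAA_def P_def
    by simp
  also have "(\<Sum>i\<in>A. \<Sum>j\<in>A. (\<Sum>k\<in>B. \<bar>u k i - u k j\<bar>) * \<rho> i j) = U"
    unfolding U_def sum_distrib_right
    by (subst (2) sum.swap, subst sum.swap[of _ B]) simp
  finally have G: "b * ?G = 2 * c * SAP + 2 * b * SaP - U - 2 * b * dAA - 2 * b * h * P"
    by simp
  define dAB where "dAB = (\<Sum>i\<in>A. \<Sum>k\<in>B. d i k * \<rho> i k)"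
  define SaR where "SaR = (\<Sum>i\<in>A. \<alpha> i * (\<Sum>k\<in>B. \<rho> i k))"
  define SBR where "SBR = (\<Sum>k\<in>B. (\<Sum>i\<in>A. d i k) * (\<Sum>i\<in>A. \<rho> i k))"
  define R where "R = (\<Sum>i\<in>A. \<Sum>k\<in>B. \<rho> i k)"
  define sa where "sa = (\<Sum>i\<in>A. \<alpha> i)"
  have "(\<Sum>k\<in>B. 2 * a * (\<Sum>i\<in>A. u k i * \<rho> i k))
      \<le> (\<Sum>k\<in>B. 2 * (\<Sum>i\<in>A. u k i) * (\<Sum>i\<in>A. \<rho> i k) + (\<Sum>i\<in>A. \<Sum>j\<in>A. \<bar>u k i - u k j\<bar> * \<rho> i j))"
    unfolding a_def by (intro sum_mono sum_mult_le_average A lip)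
  also have "\<dots> = 2 * (\<Sum>k\<in>B. (\<Sum>i\<in>A. u k i) * (\<Sum>i\<in>A. \<rho> i k)) + U"
    by (simp add: sum.distrib U_def mult.assoc flip: sum_distrib_left)
  also have "(\<Sum>k\<in>B. (\<Sum>i\<in>A. u k i) * (\<Sum>i\<in>A. \<rho> i k)) = c * SBR - sa * R"
  proof -
    have "(\<Sum>k\<in>B. (\<Sum>i\<in>A. u k i) * (\<Sum>i\<in>A. \<rho> i k))
        = (\<Sum>k\<in>B. c * ((\<Sum>i\<in>A. d i k) * (\<Sum>i\<in>A. \<rho> i k)) - sa * (\<Sum>i\<in>A. \<rho> i k))"
      by (simp add: u_def sum_subtractf sum_distrib_left[symmetric] sa_def algebra_simps)
    also have "\<dots> = c * SBR - sa * R"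
      unfolding R_def SBR_def sum.swap[of _ B A] by (simp add: sum_subtractf flip: sum_distrib_left)
    finally show ?thesis .
  qed
  also have "(\<Sum>k\<in>B. 2 * a * (\<Sum>i\<in>A. u k i * \<rho> i k)) = 2 * a * (c * dAB - SaR)"
  proof -
    have "(\<Sum>k\<in>B. \<Sum>i\<in>A. u k i * \<rho> i k) = (\<Sum>i\<in>A. \<Sum>k\<in>B. c * (d i k * \<rho> i k) - \<alpha> i * \<rho> i k)"
      by (subst sum.swap) (simp add: u_def algebra_simps)
    also have "\<dots> = c * dAB - SaR"
      by (simp add: sum_subtractf sum_distrib_left dAB_def SaR_def)
    finally show ?thesis
      by (simp add: sum_distrib_left[symmetric])
  qed
  finally have T: "2 * a * (c * dAB - SaR) \<le> 2 * (c * SBR - sa * R) + U" .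
  define G where "G = ?G"
  have "b * (G / 2) \<le> b * (c / b * (SAP + SBR) + SaP - sa / b * R - dAA - h * P - a / b * (c * dAB - SaR))"
  proof -
    have cancel: "b * (x / b * y) = x * y" for x y
      using pos by simp
    show ?thesis
      using G T unfolding G_def[symmetric] distrib_left right_diff_distrib cancel
      by (simp add: algebra_simps)
  qed
  then show ?thesis
    using pos unfolding G_def SAP_def SBR_def SaP_def sa_def R_def dAA_def P_def dAB_def SaR_def a_def b_def
    by (simp only: mult_le_cancel_left_pos)
qed

section \<open>Using nonnegativity across the clusters\<close>

text \<open>Sum \<open>0 \<le> X i k\<close> over \<open>k\<close> in \<open>B\<close> and express the diagonal entries that
  result through row sums of the semimetric.\<close>

lemma cross_gap_le:
  assumes X: "lp2_feasible n X" and part: "A \<union> B = {1..n}" "A \<inter> B = {}" and i: "i \<in> A"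
  shows "real (card A) * (\<Sum>k\<in>B. gap X i k) \<le> real (card B) * (\<Sum>j\<in>A. gap X i j)
    + (\<Sum>k\<in>B. \<Sum>l\<in>B. gap X k l) + (\<Sum>j\<in>A. \<Sum>k\<in>B. gap X j k)"
proof -
  have fin: "finite A" "finite B"
    using part(1) by (metis finite_Un finite_atLeastAtMost)+
  have n: "real n = real (card A) + real (card B)"
    using card_Un_disjoint[OF fin part(2)] part(1) by simp
  have split: "(\<Sum>j\<in>{1..n}. f j) = (\<Sum>j\<in>A. f j) + (\<Sum>j\<in>B. f j)" for f :: "nat \<Rightarrow> real"
    using sum.union_disjoint[OF fin part(2)] part(1) by simp
  have diag: "real n * X j j = 2 * ((\<Sum>k\<in>A. gap X j k) + (\<Sum>k\<in>B. gap X j k))" if "j \<in> A \<union> B" for j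
    using sum_gap[OF X, of j] that part(1) split[of "gap X j"] by simp
  have "gap X i k \<le> (X i i + X k k) / 2" if "k \<in> B" for k
  proof -
    have mem: "i \<in> {1..n}" "k \<in> {1..n}" "i \<noteq> k"
      using that i part by auto
    then have "0 \<le> X i k"
      using X unfolding lp2_feasible_def by (metis nat_neq_iff)
    then show ?thesis
      using gap_eq[OF X mem(1,2)] by linarith
  qed
  then have "real n * (\<Sum>k\<in>B. gap X i k) \<le> real n * (\<Sum>k\<in>B. (X i i + X k k) / 2)"
    by (intro mult_left_mono sum_mono) auto
  also have "\<dots> = (real (card B) * (real n * X i i) + (\<Sum>k\<in>B. real n * X k k)) / 2"
    by (simp add: sum.distrib sum_distrib_left algebra_simps flip: sum_divide_distrib)
  also have "(\<Sum>k\<in>B. real n * X k k) = (\<Sum>k\<in>B. 2 * ((\<Sum>l\<in>A. gap X k l) + (\<Sum>l\<in>B. gap X k l)))"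
    by (intro sum.cong refl diag) simp
  also have "\<dots> = 2 * ((\<Sum>j\<in>A. \<Sum>k\<in>B. gap X j k) + (\<Sum>k\<in>B. \<Sum>l\<in>B. gap X k l))"
    by (subst sum.swap) (simp add: sum.distrib gap_commute flip: sum_distrib_left)
  finally show ?thesis
    unfolding diag[OF UnI1[OF i]] by (simp add: n algebra_simps)
qed

lemma weighted_cross_gap_le:
  assumes X: "lp2_feasible n X" and part: "A \<union> B = {1..n}" "A \<inter> B = {}"
    and w: "\<And>i. i \<in> A \<Longrightarrow> 0 \<le> w i"
  shows "real (card A) * (\<Sum>i\<in>A. w i * (\<Sum>k\<in>B. gap X i k))
    \<le> real (card B) * (\<Sum>i\<in>A. w i * (\<Sum>j\<in>A. gap X i j))
      + (\<Sum>i\<in>A. w i) * ((\<Sum>k\<in>B. \<Sum>l\<in>B. gap X k l) + (\<Sum>j\<in>A. \<Sum>k\<in>B. gap X j k))"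
proof -
  define S where "S = (\<Sum>k\<in>B. \<Sum>l\<in>B. gap X k l) + (\<Sum>j\<in>A. \<Sum>k\<in>B. gap X j k)"
  have "real (card A) * (\<Sum>i\<in>A. w i * (\<Sum>k\<in>B. gap X i k))
      = (\<Sum>i\<in>A. w i * (real (card A) * (\<Sum>k\<in>B. gap X i k)))"
    unfolding sum_distrib_left[of "real (card A)" _ A] by (intro sum.cong refl) (simp only: ac_simps)
  also have "\<dots> \<le> (\<Sum>i\<in>A. w i * (real (card B) * (\<Sum>j\<in>A. gap X i j) + S))"
    using cross_gap_le[OF X part] w by (intro sum_mono mult_left_mono) (simp_all add: S_def add.assoc)
  also have "\<dots> = (\<Sum>i\<in>A. real (card B) * (w i * (\<Sum>j\<in>A. gap X i j)) + w i * S)"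
    by (intro sum.cong refl) (simp only: algebra_simps)
  also have "\<dots> = real (card B) * (\<Sum>i\<in>A. w i * (\<Sum>j\<in>A. gap X i j)) + (\<Sum>i\<in>A. w i) * S"
    by (simp only: sum.distrib sum_distrib_left sum_distrib_right)
  finally show ?thesis
    unfolding S_def .
qed

section \<open>The lower bound for the objective\<close>

lemma gamma_in_first:
  assumes "\<And>i j. d i j = d j i" "i \<in> \<Gamma>1" "j \<in> \<Gamma>1"
  shows "gamma d \<Gamma>1 \<Gamma>2 i j = 2 / real (card \<Gamma>2) *
      (\<Sum>k\<in>\<Gamma>2. min (cluster_ratio \<Gamma>1 \<Gamma>2 \<Gamma>2 * d i k + d_in d \<Gamma>1 j)
                  (cluster_ratio \<Gamma>1 \<Gamma>2 \<Gamma>2 * d j k + d_in d \<Gamma>1 i))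
    - 2 * d i j - 2 * eta d \<Gamma>1 \<Gamma>2"
  using assms by (simp add: gamma_def gamma_less_def Let_def min.commute)

lemma gamma_in_second:
  assumes "\<And>i j. d i j = d j i" "i \<in> \<Gamma>2" "j \<in> \<Gamma>2" "\<Gamma>1 \<inter> \<Gamma>2 = {}"
  shows "gamma d \<Gamma>1 \<Gamma>2 i j = 2 / real (card \<Gamma>1) *
      (\<Sum>k\<in>\<Gamma>1. min (cluster_ratio \<Gamma>1 \<Gamma>2 \<Gamma>1 * d i k + d_in d \<Gamma>2 j)
                  (cluster_ratio \<Gamma>1 \<Gamma>2 \<Gamma>1 * d j k + d_in d \<Gamma>2 i))
    - 2 * d i j - 2 * (cluster_ratio \<Gamma>1 \<Gamma>2 \<Gamma>1 / cluster_ratio \<Gamma>1 \<Gamma>2 \<Gamma>2 * eta d \<Gamma>1 \<Gamma>2)"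
proof -
  have "i \<notin> \<Gamma>1" "j \<notin> \<Gamma>1" using assms by auto
  then show ?thesis
    using assms by (simp add: gamma_def gamma_less_def Let_def min.commute)
qed

lemma objective_eq_gap:
  assumes X: "lp2_feasible n X" and sym: "\<And>i j. d i j = d j i" and "n > 0"
  shows "lp2_objective n d X = (\<Sum>i\<in>{1..n}. 2 / real n * ((\<Sum>j\<in>{1..n}. d i j) * (\<Sum>j\<in>{1..n}. gap X i j))
    - (\<Sum>j\<in>{1..n}. d i j * gap X i j))"
proof -
  have "lp2_objective n d X = (\<Sum>i\<in>{1..n}. \<Sum>j\<in>{1..n}. d i j * X i i / 2 + d i j * X j j / 2 - d i j * gap X i j)"
    unfolding lp2_objective_def
    by (intro sum.cong refl) (simp add: gap_eq[OF X] field_simps)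
  also have "\<dots> = (\<Sum>i\<in>{1..n}. \<Sum>j\<in>{1..n}. d i j * X i i / 2) + (\<Sum>i\<in>{1..n}. \<Sum>j\<in>{1..n}. d i j * X j j / 2)
      - (\<Sum>i\<in>{1..n}. \<Sum>j\<in>{1..n}. d i j * gap X i j)"
    by (simp add: sum.distrib sum_subtractf)
  also have "(\<Sum>i\<in>{1..n}. \<Sum>j\<in>{1..n}. d i j * X j j / 2) = (\<Sum>i\<in>{1..n}. \<Sum>j\<in>{1..n}. d i j * X i i / 2)"
    by (subst sum.swap) (intro sum.cong refl, simp only: sym)
  also have "(\<Sum>i\<in>{1..n}. \<Sum>j\<in>{1..n}. d i j * X i i / 2) + (\<Sum>i\<in>{1..n}. \<Sum>j\<in>{1..n}. d i j * X i i / 2)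
     = (\<Sum>i\<in>{1..n}. (\<Sum>j\<in>{1..n}. d i j) * X i i)"
    by (simp flip: sum_distrib_right sum_divide_distrib)
  also have "\<dots> = (\<Sum>i\<in>{1..n}. 2 / real n * ((\<Sum>j\<in>{1..n}. d i j) * (\<Sum>j\<in>{1..n}. gap X i j)))"
    using \<open>n > 0\<close> by (intro sum.cong refl) (simp only: sum_gap[OF X], simp)
  finally show ?thesis
    by (simp add: sum_subtractf)
qed

text \<open>The rows of the objective that belong to the cluster \<open>A\<close>, split into distances inside \<open>A\<close> and
  distances to \<open>B\<close>; the aggregates are those of \<open>cluster_transport\<close>.\<close>

lemma cluster_part_objective:
  fixes A B :: "nat set"
  assumes part: "A \<union> B = {1..n}" "A \<inter> B = {}" and "A \<noteq> {}"
  shows "(\<Sum>i\<in>A. 2 / real n * ((\<Sum>j\<in>{1..n}. d i j) * (\<Sum>j\<in>{1..n}. \<rho> i j)) - (\<Sum>j\<in>{1..n}. d i j * \<rho> i j))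
    = 2 / real n * (real (card A) * (\<Sum>i\<in>A. d_in d A i * (\<Sum>j\<in>A. \<rho> i j))
        + real (card A) * (\<Sum>i\<in>A. d_in d A i * (\<Sum>k\<in>B. \<rho> i k))
        + (\<Sum>i\<in>A. (\<Sum>k\<in>B. d i k) * (\<Sum>j\<in>A. \<rho> i j))
        + (\<Sum>i\<in>A. (\<Sum>k\<in>B. d i k) * (\<Sum>k\<in>B. \<rho> i k)))
      - (\<Sum>i\<in>A. \<Sum>j\<in>A. d i j * \<rho> i j) - (\<Sum>i\<in>A. \<Sum>k\<in>B. d i k * \<rho> i k)"
proof -
  have fin: "finite A" "finite B"
    using part(1) by (metis finite_Un finite_atLeastAtMost)+
  have split: "(\<Sum>j\<in>{1..n}. f j) = (\<Sum>j\<in>A. f j) + (\<Sum>j\<in>B. f j)" for f :: "nat \<Rightarrow> real"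
    using sum.union_disjoint[OF fin part(2)] part(1) by simp
  have din: "(\<Sum>j\<in>A. d i j) = real (card A) * d_in d A i" for i
    using fin \<open>A \<noteq> {}\<close> by (simp add: d_in_def)
  show ?thesis
    unfolding split din
    by (simp add: sum.distrib sum_subtractf algebra_simps flip: sum_distrib_left sum_divide_distrib)
qed

text \<open>The linear combination of all inequalities, for sums that are treated as opaque numbers. \<open>P\<close>, \<open>Q\<close>
  and \<open>R\<close> are the masses of the semimetric inside the first cluster, inside the second and across,
  \<open>sa\<close> and \<open>sb\<close> are the sums of \<open>d_in\<close>, and in names like \<open>SaP\<close> the middle letter stands for the
  weight (\<open>a\<close>, \<open>b\<close> for \<open>d_in\<close> and \<open>A\<close>, \<open>B\<close> for the sum of the distances to the other cluster) and
  the last for the row sums that it multiplies; \<open>dAA\<close>, \<open>dBB\<close> and \<open>dAB\<close> are the sums of the distances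
  times the semimetric. The bounds \<open>G1\<close> and \<open>G2\<close> leave the
  excess \<open>E\<close>, which turns out to be a combination of the slacks of \<open>w1\<close> and \<open>w2\<close> with the
  coefficients \<open>(b - a) / (n * b)\<close> and \<open>(b - a) / (n * a)\<close>. This is the point where the first
  cluster must not be larger than the second; it is also what dictates the value of \<open>\<eta>\<close>.\<close>

lemma certificate_arithmetic:
  fixes a b :: real
  assumes pos: "0 < a" "a \<le> b" and n: "n = a + b"
    and norm: "P + Q + 2 * R = n"
    and eta: "\<eta> = b / n * ((1 - a / b) * M + (1 - b / a) * m + a / b * (1 / a) * sa + b / a * (1 / b) * sb)"
    and G1: "G1 / 2 \<le> 2 / n * (SAP + SBR) + SaP - sa / b * R - dAA - \<eta> * P - a / b * (2 * b / n * dAB - SaR)"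
    and G2: "G2 / 2 \<le> 2 / n * (SBQ + SAR) + SbQ - sb / a * R - dBB - a / b * \<eta> * Q - b / a * (2 * a / n * dAB - SbR)"
    and w1: "a * (M * R - SaR) \<le> b * (M * P - SaP) + (a * M - sa) * (Q + R)"
    and w2: "b * (SbR - m * R) \<le> a * (SbQ - m * Q) + (sb - b * m) * (P + R)"
    and obj: "obj = (2 / n * (a * SaP + a * SaR + SAP + SAR) - dAA - dAB) + (2 / n * (b * SbQ + b * SbR + SBQ + SBR) - dBB - dAB)"
  shows "(G1 + G2) / 2 \<le> obj - (sa + sb)"
proof -
  have n0: "n > 0" "b > 0" "a \<noteq> 0" "b \<noteq> 0" "a + b \<noteq> 0" using pos n by auto
  \<comment> \<open>\<open>sa + sb\<close> is multiplied by \<open>(P + Q + 2 * R) / n = 1\<close>, to make \<open>E\<close> homogeneous in the masses.\<close>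
  define E where "E = 2 / n * (a * SaP + a * SaR) + 2 / n * (b * SbQ + b * SbR) - (sa + sb) * (P + Q + 2 * R) / n
    - SaP + sa / b * R + \<eta> * P - a / b * SaR - SbQ + sb / a * R + a / b * \<eta> * Q - b / a * SbR"
  have transport: "a / b * (2 * b / n * dAB - SaR) = 2 * a / n * dAB - a / b * SaR"
    "b / a * (2 * a / n * dAB - SbR) = 2 * b / n * dAB - b / a * SbR"
    using n0 by (simp_all add: field_simps)
  have "2 * a / n * dAB + 2 * b / n * dAB = 2 * ((a + b) / n) * dAB"
    by (simp add: add_divide_distrib algebra_simps)
  then have "2 * a / n * dAB + 2 * b / n * dAB = 2 * dAB"
    using n n0 by simp
  moreover have "(sa + sb) * (P + Q + 2 * R) / n = sa + sb"
    using n0 norm by simp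
  moreover define c where "c = 2 / n"
  ultimately have "E \<le> obj - (sa + sb) - (G1 + G2) / 2"
    using G1[unfolded transport] G2[unfolded transport]
    unfolding E_def obj c_def[symmetric] by (simp add: algebra_simps add_divide_distrib)
  moreover have "E = (b - a) / (n * b) * (b * (M * P - SaP) + (a * M - sa) * (Q + R) - a * (M * R - SaR))
    + (b - a) / (n * a) * (a * (SbQ - m * Q) + (sb - b * m) * (P + R) - b * (SbR - m * R))"
    unfolding E_def eta using n0 by (simp add: field_simps) (simp add: n algebra_simps)
  moreover have "0 \<le> (b - a) / (n * b) * (b * (M * P - SaP) + (a * M - sa) * (Q + R) - a * (M * R - SaR))"
    "0 \<le> (b - a) / (n * a) * (a * (SbQ - m * Q) + (sb - b * m) * (P + R) - b * (SbR - m * R))"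
    using w1 w2 pos n0 by (intro mult_nonneg_nonneg; simp)+
  ultimately show ?thesis by linarith
qed

text \<open>Weak duality: the multipliers of the constraints that touch both clusters are fixed here once and for
  all, and the weighted sum on the left is the part of the certificate that only involves
  pairs inside a cluster and is left to the algorithm.\<close>

lemma gamma_gap_sum_le:
  assumes part: "bipartition n \<Gamma>1 \<Gamma>2" and le: "card \<Gamma>1 \<le> card \<Gamma>2"
    and sym: "\<And>i j. d i j = d j i" and X: "lp2_feasible n X"
  shows "((\<Sum>i\<in>\<Gamma>1. \<Sum>j\<in>\<Gamma>1. gamma d \<Gamma>1 \<Gamma>2 i j * gap X i j)
       + (\<Sum>i\<in>\<Gamma>2. \<Sum>j\<in>\<Gamma>2. gamma d \<Gamma>1 \<Gamma>2 i j * gap X i j)) / 2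
    \<le> lp2_objective n d X - ((\<Sum>i\<in>\<Gamma>1. d_in d \<Gamma>1 i) + (\<Sum>i\<in>\<Gamma>2. d_in d \<Gamma>2 i))"
proof -
  have ne: "\<Gamma>1 \<noteq> {}" "\<Gamma>2 \<noteq> {}" and un: "\<Gamma>1 \<union> \<Gamma>2 = {1..n}" "\<Gamma>2 \<union> \<Gamma>1 = {1..n}"
    and dis: "\<Gamma>1 \<inter> \<Gamma>2 = {}" "\<Gamma>2 \<inter> \<Gamma>1 = {}"
    using part unfolding bipartition_def by auto
  have fin: "finite \<Gamma>1" "finite \<Gamma>2"
    using un(1) by (metis finite_Un finite_atLeastAtMost)+
  define a b where "a = real (card \<Gamma>1)" and "b = real (card \<Gamma>2)"
  have pos: "0 < a" "a \<le> b"
    using ne fin le by (auto simp: a_def b_def card_gt_0_iff)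
  have n: "real n = a + b"
    using card_Un_disjoint[OF fin dis(1)] un(1) by (simp add: a_def b_def)
  have split: "(\<Sum>j\<in>{1..n}. f j) = (\<Sum>j\<in>\<Gamma>1. f j) + (\<Sum>j\<in>\<Gamma>2. f j)" for f :: "nat \<Rightarrow> real"
    using sum.union_disjoint[OF fin dis(1)] un(1) by simp
  define M m where "M = (MAX k\<in>\<Gamma>1. d_in d \<Gamma>1 k)" and "m = (MIN k\<in>\<Gamma>2. d_in d \<Gamma>2 k)"
  have M: "0 \<le> M - d_in d \<Gamma>1 i" if "i \<in> \<Gamma>1" for i
    using fin that by (simp add: M_def)
  have m: "0 \<le> d_in d \<Gamma>2 k - m" if "k \<in> \<Gamma>2" for k
    using fin that by (simp add: m_def)
  define R where "R = (\<Sum>i\<in>\<Gamma>1. \<Sum>k\<in>\<Gamma>2. gap X i k)"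
  have R_swap: "(\<Sum>k\<in>\<Gamma>2. \<Sum>i\<in>\<Gamma>1. gap X k i) = R"
    unfolding R_def by (subst sum.swap) (simp only: gap_commute)
  define dAB where "dAB = (\<Sum>i\<in>\<Gamma>1. \<Sum>k\<in>\<Gamma>2. d i k * gap X i k)"
  have dAB_swap: "(\<Sum>k\<in>\<Gamma>2. \<Sum>i\<in>\<Gamma>1. d k i * gap X k i) = dAB"
    unfolding dAB_def by (subst sum.swap) (simp only: gap_commute sym)
  have r: "cluster_ratio \<Gamma>1 \<Gamma>2 \<Gamma>1 = 2 * a / n" "cluster_ratio \<Gamma>1 \<Gamma>2 \<Gamma>2 = 2 * b / n"
    by (simp_all add: cluster_ratio_def n a_def b_def)
  have ratio: "2 * a / real n / (2 * b / real n) = a / b" "2 * b / real n / (2 * a / real n) = b / a"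
    using pos n by auto
  have lip: "\<bar>gap X i k - gap X j k\<bar> \<le> gap X i j"
    if "i \<in> A" "j \<in> A" "k \<in> B" "A \<union> B = {1..n}" "A \<inter> B = {}" for A B i j k
  proof (cases "i = j")
    case False
    have "i \<in> {1..n}" "j \<in> {1..n}" "k \<in> {1..n}" "i \<noteq> k" "j \<noteq> k"
      using that by auto
    with False have "gap X i k \<le> gap X i j + gap X j k" "gap X j k \<le> gap X j i + gap X i k"
      by (auto intro!: gap_triangle[OF X])
    then show ?thesis
      using gap_commute[of X i j] by linarith
  qed simp
  note transport1 = cluster_transport[where \<rho> = "gap X" and c = "2 * b / n" and d = d
        and \<alpha> = "d_in d \<Gamma>1" and h = "eta d \<Gamma>1 \<Gamma>2",
      OF fin(1) ne(1) fin(2) ne(2) gap_commute lip[OF _ _ _ un(1) dis(1)]]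
  note transport2 = cluster_transport[where \<rho> = "gap X" and c = "2 * a / n" and d = d
        and \<alpha> = "d_in d \<Gamma>2" and h = "a / b * eta d \<Gamma>1 \<Gamma>2",
      OF fin(2) ne(2) fin(1) ne(1) gap_commute lip[OF _ _ _ un(2) dis(2)]]
  have c: "2 * b / real n / b = 2 / n" "2 * a / real n / a = 2 / n"
    using pos by auto
  show ?thesis
  proof (rule certificate_arithmetic[OF pos n, where R = R and M = M and m = m and dAB = dAB
        and \<eta> = "eta d \<Gamma>1 \<Gamma>2"
        and P = "\<Sum>i\<in>\<Gamma>1. \<Sum>j\<in>\<Gamma>1. gap X i j" and Q = "\<Sum>i\<in>\<Gamma>2. \<Sum>j\<in>\<Gamma>2. gap X i j"
        and dAA = "\<Sum>i\<in>\<Gamma>1. \<Sum>j\<in>\<Gamma>1. d i j * gap X i j" and dBB = "\<Sum>i\<in>\<Gamma>2. \<Sum>j\<in>\<Gamma>2. d i j * gap X i j"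
        and SaP = "\<Sum>i\<in>\<Gamma>1. d_in d \<Gamma>1 i * (\<Sum>j\<in>\<Gamma>1. gap X i j)"
        and SaR = "\<Sum>i\<in>\<Gamma>1. d_in d \<Gamma>1 i * (\<Sum>k\<in>\<Gamma>2. gap X i k)"
        and SAP = "\<Sum>i\<in>\<Gamma>1. (\<Sum>k\<in>\<Gamma>2. d i k) * (\<Sum>j\<in>\<Gamma>1. gap X i j)"
        and SAR = "\<Sum>i\<in>\<Gamma>1. (\<Sum>k\<in>\<Gamma>2. d i k) * (\<Sum>k\<in>\<Gamma>2. gap X i k)"
        and SbQ = "\<Sum>i\<in>\<Gamma>2. d_in d \<Gamma>2 i * (\<Sum>j\<in>\<Gamma>2. gap X i j)"
        and SbR = "\<Sum>i\<in>\<Gamma>2. d_in d \<Gamma>2 i * (\<Sum>k\<in>\<Gamma>1. gap X i k)"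
        and SBQ = "\<Sum>i\<in>\<Gamma>2. (\<Sum>k\<in>\<Gamma>1. d i k) * (\<Sum>j\<in>\<Gamma>2. gap X i j)"
        and SBR = "\<Sum>i\<in>\<Gamma>2. (\<Sum>k\<in>\<Gamma>1. d i k) * (\<Sum>k\<in>\<Gamma>1. gap X i k)"])
    show "(\<Sum>i\<in>\<Gamma>1. \<Sum>j\<in>\<Gamma>1. gap X i j) + (\<Sum>i\<in>\<Gamma>2. \<Sum>j\<in>\<Gamma>2. gap X i j) + 2 * R = n"
    proof -
      have "(\<Sum>i\<in>{1..n}. \<Sum>j\<in>{1..n}. gap X i j) = (\<Sum>i\<in>{1..n}. real n / 2 * X i i)"
        using sum_gap[OF X] by (intro sum.cong refl) simp
      also have "\<dots> = real n / 2 * 2"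
        using X unfolding sum_distrib_left[symmetric] lp2_feasible_def by simp
      finally show ?thesis
        unfolding split by (simp only: sum.distrib R_swap R_def[symmetric])
    qed
  next
    show "eta d \<Gamma>1 \<Gamma>2 = b / n * ((1 - a / b) * M + (1 - b / a) * m
        + a / b * (1 / a) * (\<Sum>i\<in>\<Gamma>1. d_in d \<Gamma>1 i) + b / a * (1 / b) * (\<Sum>i\<in>\<Gamma>2. d_in d \<Gamma>2 i))"
      unfolding eta_def Let_def r ratio M_def m_def a_def[symmetric] b_def[symmetric] by simp
  next
    have "(\<Sum>k\<in>\<Gamma>2. (\<Sum>i\<in>\<Gamma>1. d i k) * (\<Sum>i\<in>\<Gamma>1. gap X i k)) = (\<Sum>i\<in>\<Gamma>2. (\<Sum>k\<in>\<Gamma>1. d i k) * (\<Sum>k\<in>\<Gamma>1. gap X i k))"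
      by (simp only: gap_commute sym)
    then show "(\<Sum>i\<in>\<Gamma>1. \<Sum>j\<in>\<Gamma>1. gamma d \<Gamma>1 \<Gamma>2 i j * gap X i j) / 2
      \<le> 2 / n * ((\<Sum>i\<in>\<Gamma>1. (\<Sum>k\<in>\<Gamma>2. d i k) * (\<Sum>j\<in>\<Gamma>1. gap X i j)) + (\<Sum>i\<in>\<Gamma>2. (\<Sum>k\<in>\<Gamma>1. d i k) * (\<Sum>k\<in>\<Gamma>1. gap X i k)))
        + (\<Sum>i\<in>\<Gamma>1. d_in d \<Gamma>1 i * (\<Sum>j\<in>\<Gamma>1. gap X i j)) - (\<Sum>i\<in>\<Gamma>1. d_in d \<Gamma>1 i) / b * R
        - (\<Sum>i\<in>\<Gamma>1. \<Sum>j\<in>\<Gamma>1. d i j * gap X i j) - eta d \<Gamma>1 \<Gamma>2 * (\<Sum>i\<in>\<Gamma>1. \<Sum>j\<in>\<Gamma>1. gap X i j)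
        - a / b * (2 * b / n * dAB - (\<Sum>i\<in>\<Gamma>1. d_in d \<Gamma>1 i * (\<Sum>k\<in>\<Gamma>2. gap X i k)))"
      using transport1
      by (simp only: gamma_in_first[OF sym] r a_def[symmetric] b_def[symmetric] c dAB_def R_def cong: sum.cong)
  next
    have "(\<Sum>k\<in>\<Gamma>1. (\<Sum>i\<in>\<Gamma>2. d i k) * (\<Sum>i\<in>\<Gamma>2. gap X i k)) = (\<Sum>i\<in>\<Gamma>1. (\<Sum>k\<in>\<Gamma>2. d i k) * (\<Sum>k\<in>\<Gamma>2. gap X i k))"
      by (simp only: gap_commute sym)
    then show "(\<Sum>i\<in>\<Gamma>2. \<Sum>j\<in>\<Gamma>2. gamma d \<Gamma>1 \<Gamma>2 i j * gap X i j) / 2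
      \<le> 2 / n * ((\<Sum>i\<in>\<Gamma>2. (\<Sum>k\<in>\<Gamma>1. d i k) * (\<Sum>j\<in>\<Gamma>2. gap X i j)) + (\<Sum>i\<in>\<Gamma>1. (\<Sum>k\<in>\<Gamma>2. d i k) * (\<Sum>k\<in>\<Gamma>2. gap X i k)))
        + (\<Sum>i\<in>\<Gamma>2. d_in d \<Gamma>2 i * (\<Sum>j\<in>\<Gamma>2. gap X i j)) - (\<Sum>i\<in>\<Gamma>2. d_in d \<Gamma>2 i) / a * R
        - (\<Sum>i\<in>\<Gamma>2. \<Sum>j\<in>\<Gamma>2. d i j * gap X i j) - a / b * eta d \<Gamma>1 \<Gamma>2 * (\<Sum>i\<in>\<Gamma>2. \<Sum>j\<in>\<Gamma>2. gap X i j)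
        - b / a * (2 * a / n * dAB - (\<Sum>i\<in>\<Gamma>2. d_in d \<Gamma>2 i * (\<Sum>k\<in>\<Gamma>1. gap X i k)))"
      using transport2
      by (simp only: gamma_in_second[OF sym _ _ dis(1)] r ratio a_def[symmetric] b_def[symmetric] c dAB_swap R_swap cong: sum.cong)
  next
    show "a * (M * R - (\<Sum>i\<in>\<Gamma>1. d_in d \<Gamma>1 i * (\<Sum>k\<in>\<Gamma>2. gap X i k)))
      \<le> b * (M * (\<Sum>i\<in>\<Gamma>1. \<Sum>j\<in>\<Gamma>1. gap X i j) - (\<Sum>i\<in>\<Gamma>1. d_in d \<Gamma>1 i * (\<Sum>j\<in>\<Gamma>1. gap X i j)))
        + (a * M - (\<Sum>i\<in>\<Gamma>1. d_in d \<Gamma>1 i)) * ((\<Sum>i\<in>\<Gamma>2. \<Sum>j\<in>\<Gamma>2. gap X i j) + R)"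
      using weighted_cross_gap_le[OF X un(1) dis(1) M]
      by (simp add: left_diff_distrib sum_subtractf a_def b_def R_def flip: sum_distrib_left)
  next
    show "b * ((\<Sum>i\<in>\<Gamma>2. d_in d \<Gamma>2 i * (\<Sum>k\<in>\<Gamma>1. gap X i k)) - m * R)
      \<le> a * ((\<Sum>i\<in>\<Gamma>2. d_in d \<Gamma>2 i * (\<Sum>j\<in>\<Gamma>2. gap X i j)) - m * (\<Sum>i\<in>\<Gamma>2. \<Sum>j\<in>\<Gamma>2. gap X i j))
        + ((\<Sum>i\<in>\<Gamma>2. d_in d \<Gamma>2 i) - b * m) * ((\<Sum>i\<in>\<Gamma>1. \<Sum>j\<in>\<Gamma>1. gap X i j) + R)"
      using weighted_cross_gap_le[OF X un(2) dis(2) m]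
      by (simp add: left_diff_distrib sum_subtractf a_def b_def R_swap flip: sum_distrib_left)
  next
    have "n > 0" using pos n by simp
    show "lp2_objective n d X
      = (2 / n * (a * (\<Sum>i\<in>\<Gamma>1. d_in d \<Gamma>1 i * (\<Sum>j\<in>\<Gamma>1. gap X i j))
          + a * (\<Sum>i\<in>\<Gamma>1. d_in d \<Gamma>1 i * (\<Sum>k\<in>\<Gamma>2. gap X i k))
          + (\<Sum>i\<in>\<Gamma>1. (\<Sum>k\<in>\<Gamma>2. d i k) * (\<Sum>j\<in>\<Gamma>1. gap X i j))
          + (\<Sum>i\<in>\<Gamma>1. (\<Sum>k\<in>\<Gamma>2. d i k) * (\<Sum>k\<in>\<Gamma>2. gap X i k)))
          - (\<Sum>i\<in>\<Gamma>1. \<Sum>j\<in>\<Gamma>1. d i j * gap X i j) - dAB)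
      + (2 / n * (b * (\<Sum>i\<in>\<Gamma>2. d_in d \<Gamma>2 i * (\<Sum>j\<in>\<Gamma>2. gap X i j))
          + b * (\<Sum>i\<in>\<Gamma>2. d_in d \<Gamma>2 i * (\<Sum>k\<in>\<Gamma>1. gap X i k))
          + (\<Sum>i\<in>\<Gamma>2. (\<Sum>k\<in>\<Gamma>1. d i k) * (\<Sum>j\<in>\<Gamma>2. gap X i j))
          + (\<Sum>i\<in>\<Gamma>2. (\<Sum>k\<in>\<Gamma>1. d i k) * (\<Sum>k\<in>\<Gamma>1. gap X i k)))
          - (\<Sum>i\<in>\<Gamma>2. \<Sum>j\<in>\<Gamma>2. d i j * gap X i j) - dAB)"
      unfolding objective_eq_gap[OF X sym \<open>n > 0\<close>] split[of "\<lambda>i. _ * (_ i * _ i) - _ i"]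
        cluster_part_objective[OF un(1) dis(1) ne(1)] cluster_part_objective[OF un(2) dis(2) ne(2)]
        a_def[symmetric] b_def[symmetric] dAB_def[symmetric] dAB_swap by simp
  qed
qed

section \<open>The partition matrix\<close>

lemma partition_matrix_objective:
  assumes part: "bipartition n \<Gamma>1 \<Gamma>2"
  shows "lp2_objective n d (partition_matrix \<Gamma>1 \<Gamma>2) = (\<Sum>i\<in>\<Gamma>1. d_in d \<Gamma>1 i) + (\<Sum>i\<in>\<Gamma>2. d_in d \<Gamma>2 i)"
proof -
  have un: "\<Gamma>1 \<union> \<Gamma>2 = {1..n}" using part unfolding bipartition_def by blast
  have restrict: "(\<Sum>i\<in>{1..n}. indicator A i * f i) = (\<Sum>i\<in>A. f i)" if "A \<subseteq> {1..n}" for A and f :: "nat \<Rightarrow> real"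
    using sum.inter_restrict[of "{1..n}" f A] that
    by (simp add: indicator_def Int_absorb1 if_distrib if_distribR cong: if_cong)
  have block: "(\<Sum>i\<in>{1..n}. \<Sum>j\<in>{1..n}. indicator A i * (indicator A j * (1 / real (card A) * d i j)))
      = (\<Sum>i\<in>A. d_in d A i)" if "A \<subseteq> {1..n}" for A
    unfolding sum_distrib_left[symmetric] restrict[OF that] d_in_def ..
  have "lp2_objective n d (partition_matrix \<Gamma>1 \<Gamma>2)
      = (\<Sum>i\<in>{1..n}. \<Sum>j\<in>{1..n}. indicator \<Gamma>1 i * (indicator \<Gamma>1 j * (1 / real (card \<Gamma>1) * d i j)))
      + (\<Sum>i\<in>{1..n}. \<Sum>j\<in>{1..n}. indicator \<Gamma>2 i * (indicator \<Gamma>2 j * (1 / real (card \<Gamma>2) * d i j)))"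
    unfolding lp2_objective_def partition_matrix_def by (simp add: sum.distrib[symmetric] algebra_simps)
  then show ?thesis
    using un by (simp only: block Un_upper1[of \<Gamma>1 \<Gamma>2, unfolded un] Un_upper2[of \<Gamma>2 \<Gamma>1, unfolded un])
qed

lemma partition_matrix_feasible:
  assumes part: "bipartition n \<Gamma>1 \<Gamma>2"
  shows "lp2_feasible n (partition_matrix \<Gamma>1 \<Gamma>2)"
proof -
  have ne: "\<Gamma>1 \<noteq> {}" "\<Gamma>2 \<noteq> {}" and un: "\<Gamma>1 \<union> \<Gamma>2 = {1..n}" and dis: "\<Gamma>1 \<inter> \<Gamma>2 = {}"
    using part unfolding bipartition_def by auto
  have fin: "finite \<Gamma>1" "finite \<Gamma>2"
    using un by (metis finite_Un finite_atLeastAtMost)+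
  have pos: "0 < real (card \<Gamma>1)" "0 < real (card \<Gamma>2)"
    using ne fin by (auto simp: card_gt_0_iff)
  have split: "(\<Sum>j\<in>{1..n}. f j) = (\<Sum>j\<in>\<Gamma>1. f j) + (\<Sum>j\<in>\<Gamma>2. f j)" for f :: "nat \<Rightarrow> real"
    using sum.union_disjoint[OF fin dis] un by simp
  let ?Y = "partition_matrix \<Gamma>1 \<Gamma>2"
  have Y: "?Y i j = (if i \<in> \<Gamma>1 \<and> j \<in> \<Gamma>1 then 1 / card \<Gamma>1 else if i \<in> \<Gamma>2 \<and> j \<in> \<Gamma>2 then 1 / card \<Gamma>2 else 0)"
    for i j
    using dis by (auto simp: partition_matrix_def indicator_def)
  have out: "i \<notin> \<Gamma>2" if "i \<in> \<Gamma>1" for i using dis that by blast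
  have out': "i \<notin> \<Gamma>1" if "i \<in> \<Gamma>2" for i using dis that by blast
  have "(\<Sum>j\<in>{1..n}. ?Y i j) = 1" if "i \<in> {1..n}" for i
  proof -
    have "i \<in> \<Gamma>1 \<or> i \<in> \<Gamma>2" using that un by blast
    then show ?thesis
      using pos out out' unfolding split Y by auto
  qed
  moreover have "(\<Sum>i\<in>{1..n}. ?Y i i) = 2"
    using pos out' unfolding split Y by simp
  moreover have "?Y i j + ?Y i k \<le> ?Y i i + ?Y j k" for i j k
    using out out' by (simp add: Y)
  moreover have "?Y i j = ?Y j i" "0 \<le> ?Y i j" for i j
    by (auto simp: Y)
  ultimately show ?thesis
    unfolding lp2_feasible_def by blast
qed

section \<open>Correctness of a round of the algorithm\<close>

definition cluster_pairs :: "nat set \<Rightarrow> nat set \<Rightarrow> (nat \<times> nat) set" where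
  "cluster_pairs \<Gamma>1 \<Gamma>2 = \<Gamma>1 \<times> \<Gamma>1 \<union> \<Gamma>2 \<times> \<Gamma>2"

lemma ops_tick [simp]: "ops (tick c s) = ops s + c"
  and tick_simps [simp]: "rbar (tick c s) = rbar s" "lam (tick c s) = lam s"
    "pending (tick c s) = pending s" "success (tick c s) = success s" "returned (tick c s) = returned s"
  by (simp_all add: tick_def)

text \<open>The two orientations of the edge \<open>{a, b}\<close> are both counted, whence the factor 2.\<close>

lemma sum_pairs_fun_upd:
  fixes f :: "'a set \<Rightarrow> real"
  assumes P: "finite P" "(a, b) \<in> P" "(b, a) \<in> P" and "a \<noteq> b" and comm: "\<rho> a b = \<rho> b a"
  shows "(\<Sum>(i, j)\<in>P. (f({a, b} := v)) {i, j} * \<rho> i j)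
    = (\<Sum>(i, j)\<in>P. f {i, j} * \<rho> i j) + 2 * (v - f {a, b}) * \<rho> a b"
proof -
  define \<delta> where "\<delta> = (v - f {a, b}) * \<rho> a b"
  have "(case p of (i, j) \<Rightarrow> (f({a, b} := v)) {i, j} * \<rho> i j) = (case p of (i, j) \<Rightarrow> f {i, j} * \<rho> i j)
      + (if p = (a, b) then \<delta> else 0) + (if p = (b, a) then \<delta> else 0)" for p
  proof -
    obtain i j where p: "p = (i, j)" by force
    consider "p = (a, b)" | "p = (b, a)" | "p \<noteq> (a, b)" "p \<noteq> (b, a)" by blast
    then show ?thesis
    proof cases
      case 1
      then show ?thesis using \<open>a \<noteq> b\<close> by (simp add: \<delta>_def left_diff_distrib)
    next
      case 2
      then show ?thesis
        using \<open>a \<noteq> b\<close> by (simp add: \<delta>_def left_diff_distrib insert_commute[of b a] comm)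
    next
      case 3
      then have "{i, j} \<noteq> {a, b}" by (simp add: p doubleton_eq_iff)
      then show ?thesis
        using 3 by (simp only: p prod.case fun_upd_other if_False add_0_right not_False_eq_True)
    qed
  qed
  then have "(\<Sum>(i, j)\<in>P. (f({a, b} := v)) {i, j} * \<rho> i j)
     = (\<Sum>p\<in>P. (case p of (i, j) \<Rightarrow> f {i, j} * \<rho> i j) + (if p = (a, b) then \<delta> else 0) + (if p = (b, a) then \<delta> else 0))"
    by (rule sum.cong[OF refl])
  also have "\<dots> = (\<Sum>(i, j)\<in>P. f {i, j} * \<rho> i j) + \<delta> + \<delta>"
    unfolding sum.distrib using P by simp
  finally show ?thesis
    by (simp add: \<delta>_def)
qed

text \<open>The loop invariant. The third conjunct is the potential argument: the certificate sum formed with the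
  current \<open>rbar\<close> never rises above its initial value \<open>c\<close>. The second conjunct makes an empty \<open>pending\<close>
  imply \<open>rbar \<ge> 0\<close>.\<close>

definition certifying :: "nat set \<Rightarrow> nat set \<Rightarrow> (nat \<Rightarrow> nat \<Rightarrow> real) \<Rightarrow> real \<Rightarrow> cert_state \<Rightarrow> bool" where
  "certifying \<Gamma>1 \<Gamma>2 \<rho> c s \<longleftrightarrow>
     pending s \<subseteq> {(i, j) \<in> cluster_pairs \<Gamma>1 \<Gamma>2. i < j} \<and>
     (\<forall>(i, j)\<in>cluster_pairs \<Gamma>1 \<Gamma>2. i < j \<longrightarrow> rbar s {i, j} < 0 \<longrightarrow> (i, j) \<in> pending s) \<and>
     (\<Sum>(i, j)\<in>cluster_pairs \<Gamma>1 \<Gamma>2. rbar s {i, j} * \<rho> i j) \<le> c"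

text \<open>An edge that loses weight \<open>\<omega>\<close> had at least \<open>\<omega>\<close>, so no new negative edge appears, and the potential
  drops by twice \<open>\<omega>\<close> times the slack of a triangle inequality.\<close>

lemma certifying_certify_k:
  assumes inv: "certifying \<Gamma>1 \<Gamma>2 \<rho> c s" and fin: "finite \<Gamma>1" "finite \<Gamma>2"
    and mem: "\<Gamma> \<in> {\<Gamma>1, \<Gamma>2}" "i \<in> \<Gamma>" "j \<in> \<Gamma>" "k \<in> \<Gamma>" and dist: "i < j" "k \<noteq> i" "k \<noteq> j"
    and comm: "\<And>i j. \<rho> i j = \<rho> j i" and tri: "\<rho> i j \<le> \<rho> i k + \<rho> k j"
  shows "certifying \<Gamma>1 \<Gamma>2 \<rho> c (certify_k i j k s)"
proof -
  define r where "r = rbar s"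
  define \<omega> where "\<omega> = Min {- r {i, j}, r {i, k}, r {j, k}}"
  show ?thesis
  proof (cases "\<omega> \<le> 0")
    case True
    then show ?thesis
      using inv by (simp add: certify_k_def Let_def certifying_def \<omega>_def r_def)
  next
    case False
    have le: "r {i, j} + \<omega> \<le> 0" "\<omega> \<le> r {i, k}" "\<omega> \<le> r {j, k}"
      by (simp_all add: \<omega>_def min_def)
    define r' where "r' = r({i, k} := r {i, k} - \<omega>, {j, k} := r {j, k} - \<omega>, {i, j} := r {i, j} + \<omega>)"
    have r': "rbar (certify_k i j k s) = r'"
      using False by (simp add: certify_k_def Let_def r'_def r_def \<omega>_def)
    have pend: "pending (certify_k i j k s) = (if r' {i, j} \<ge> 0 then pending s - {(i, j)} else pending s)"
      using False by (simp add: certify_k_def Let_def r'_def r_def \<omega>_def)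
    have ne: "{i, k} \<noteq> {j, k}" "{i, k} \<noteq> {i, j}" "{j, k} \<noteq> {i, j}"
      using dist by (auto simp: doubleton_eq_iff)
    let ?P = "cluster_pairs \<Gamma>1 \<Gamma>2"
    have P: "finite ?P" "(i, j) \<in> ?P" "(j, i) \<in> ?P" "(i, k) \<in> ?P" "(k, i) \<in> ?P" "(j, k) \<in> ?P" "(k, j) \<in> ?P"
      using fin mem by (auto simp: cluster_pairs_def)
    define \<Phi> where "\<Phi> f = (\<Sum>(p, q)\<in>?P. f {p, q} * \<rho> p q)" for f :: "nat set \<Rightarrow> real"
    have upd: "\<Phi> (f({p, q} := v)) = \<Phi> f + 2 * (v - f {p, q}) * \<rho> p q"
      if "(p, q) \<in> ?P" "(q, p) \<in> ?P" "p \<noteq> q" for f p q v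
      unfolding \<Phi>_def by (rule sum_pairs_fun_upd[OF P(1) that comm])
    have neq: "i \<noteq> j" "i \<noteq> k" "j \<noteq> k"
      using dist by auto
    have "\<Phi> r' = \<Phi> r - 2 * \<omega> * \<rho> i k - 2 * \<omega> * \<rho> j k + 2 * \<omega> * \<rho> i j"
      unfolding r'_def upd[OF P(2,3) neq(1)] upd[OF P(4,5) neq(2)] upd[OF P(6,7) neq(3)]
      using ne by (simp add: algebra_simps)
    also have "\<dots> = \<Phi> r - 2 * (\<omega> * (\<rho> i k + \<rho> k j - \<rho> i j))"
      unfolding comm[of j k] by (simp add: algebra_simps)
    also have "\<dots> \<le> \<Phi> r"
      using tri False by simp
    also have "\<dots> \<le> c"
      using inv unfolding certifying_def r_def \<Phi>_def by blast
    finally have "(\<Sum>(p, q)\<in>?P. r' {p, q} * \<rho> p q) \<le> c"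
      unfolding \<Phi>_def .
    moreover have "\<forall>(p, q)\<in>?P. p < q \<longrightarrow> r' {p, q} < 0 \<longrightarrow> (p, q) \<in> pending (certify_k i j k s)"
    proof (clarify)
      fix p q
      assume pq: "(p, q) \<in> ?P" "p < q" "r' {p, q} < 0"
      show "(p, q) \<in> pending (certify_k i j k s)"
      proof (cases "(p, q) = (i, j)")
        case True
        have "r {i, j} < 0" using le False by linarith
        then have "(i, j) \<in> pending s"
          using inv P(2) dist(1) unfolding certifying_def r_def by blast
        then show ?thesis using pend pq(3) True by simp
      next
        case ne_ij: False
        then have ne_edge: "{p, q} \<noteq> {i, j}"
          using pq(2) dist(1) unfolding doubleton_eq_iff by simp
        have "r {p, q} < 0"
        proof (rule ccontr)
          assume "\<not> r {p, q} < 0"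
          with le(2,3) ne_edge have "0 \<le> r' {p, q}"
            unfolding r'_def fun_upd_apply by argo
          with pq(3) show False by simp
        qed
        then have "(p, q) \<in> pending s"
          using inv pq(1,2) unfolding certifying_def r_def by blast
        with ne_ij show ?thesis unfolding pend by (split if_split) blast
      qed
    qed
    moreover have "pending (certify_k i j k s) \<subseteq> {(i, j) \<in> ?P. i < j}"
    proof -
      have "pending (certify_k i j k s) \<subseteq> pending s"
        unfolding pend by (split if_split) blast
      then show ?thesis
        using inv unfolding certifying_def by blast
    qed
    ultimately show ?thesis
      unfolding certifying_def r' by (intro conjI)
  qed
qed

lemma certifying_certify_k_loop:
  assumes "certifying \<Gamma>1 \<Gamma>2 \<rho> c s" and "finite \<Gamma>1" "finite \<Gamma>2"
    and "\<Gamma> \<in> {\<Gamma>1, \<Gamma>2}" "i \<in> \<Gamma>" "j \<in> \<Gamma>" "i < j" and "set ks \<subseteq> \<Gamma> - {i, j}"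
    and "\<And>i j. \<rho> i j = \<rho> j i" and "\<And>k. k \<in> \<Gamma> - {i, j} \<Longrightarrow> \<rho> i j \<le> \<rho> i k + \<rho> k j"
  shows "certifying \<Gamma>1 \<Gamma>2 \<rho> c (certify_k_loop i j ks s)"
  using assms
proof (induction ks arbitrary: s)
  case (Cons k ks)
  have k: "k \<in> \<Gamma>" "k \<noteq> i" "k \<noteq> j"
    using Cons.prems(8) by auto
  have "\<rho> i j \<le> \<rho> i k + \<rho> k j"
    by (rule Cons.prems(10)) (use k in simp)
  then have "certifying \<Gamma>1 \<Gamma>2 \<rho> c (certify_k i j k s)"
    by (rule certifying_certify_k[OF Cons.prems(1-6) k(1) Cons.prems(7) k(2,3) Cons.prems(9)])
  then have "certifying \<Gamma>1 \<Gamma>2 \<rho> c (certify_k_loop i j ks (certify_k i j k s))"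
    using Cons.prems(8) by (intro Cons.IH Cons.prems) auto
  with \<open>certifying \<Gamma>1 \<Gamma>2 \<rho> c (certify_k i j k s)\<close> show ?case by (simp add: Let_def)
qed simp

text \<open>The three exits of an inner step. The new contents of the arrays are abstracted to \<open>R\<close> and \<open>L\<close>, so
  that cost and control flow can be read off without case distinctions about which array entries
  coincide.\<close>

lemma certify_k_cases:
  obtains "certify_k i j k s = tick 8 s"
  | R L where "certify_k i j k s = tick 11 ((tick 8 s)\<lparr>rbar := R, lam := L\<rparr>)"
  | R L where "certify_k i j k s = tick 3 ((tick 11 ((tick 8 s)\<lparr>rbar := R, lam := L\<rparr>))
      \<lparr>success := True, pending := pending (tick 11 ((tick 8 s)\<lparr>rbar := R, lam := L\<rparr>)) - {(i, j)}\<rparr>)"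
proof -
  have "\<exists>P Q R L. certify_k i j k s = (if P then tick 8 s
      else if Q then tick 3 ((tick 11 ((tick 8 s)\<lparr>rbar := R, lam := L\<rparr>))
        \<lparr>success := True, pending := pending (tick 11 ((tick 8 s)\<lparr>rbar := R, lam := L\<rparr>)) - {(i, j)}\<rparr>)
      else tick 11 ((tick 8 s)\<lparr>rbar := R, lam := L\<rparr>))"
    unfolding certify_k_def Let_def by (intro exI) (rule refl)
  then show thesis
    using that by metis
qed

lemma certify_k_effect:
  fixes i j k s
  defines "s' \<equiv> certify_k i j k s"
  assumes "\<not> success s"
  shows "ops s' \<le> ops s + 22" "returned s' = returned s"
    "pending s' = (if success s' then pending s - {(i, j)} else pending s)"
  unfolding s'_def
  by (rule certify_k_cases[of i j k s]; use assms(2) in simp)+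

lemma certify_k_loop_effect:
  fixes i j ks s
  defines "s' \<equiv> certify_k_loop i j ks s"
  assumes "\<not> success s"
  shows "ops s' \<le> ops s + 22 * length ks \<and> returned s' = returned s \<and>
    pending s' = (if success s' then pending s - {(i, j)} else pending s)"
  using assms(2) unfolding s'_def
proof (induction ks arbitrary: s)
  case (Cons k ks)
  show ?case
  proof (cases "success (certify_k i j k s)")
    case True
    then show ?thesis
      using certify_k_effect[OF Cons.prems, of i j k] by (simp add: Let_def)
  next
    case False
    then show ?thesis
      using Cons.IH[OF False] certify_k_effect[OF Cons.prems, of i j k] by (simp add: Let_def)
  qed
qed simp

text \<open>One round of the while loop, with the choices of the schedule replaced by what is known about them.\<close>

lemma certify_body_round:
  assumes sched: "schedule \<Gamma>1 \<Gamma>2 sel visit"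
    and pend: "pending s \<subseteq> {(i, j) \<in> cluster_pairs \<Gamma>1 \<Gamma>2. i < j}" "pending s \<noteq> {}"
  obtains \<Gamma> i j ks where "\<Gamma> \<in> {\<Gamma>1, \<Gamma>2}" "i \<in> \<Gamma>" "j \<in> \<Gamma>" "i < j" "(i, j) \<in> pending s"
    and "distinct ks" "set ks = \<Gamma> - {i, j}"
    and "certify_body sel visit s = (let t = certify_k_loop i j ks (tick 12 (s\<lparr>success := False\<rparr>))
           in if success t then t else t\<lparr>returned := True\<rparr>)"
proof -
  define s0 where "s0 = tick 12 (s\<lparr>success := False\<rparr>)"
  obtain i j where ij: "sel s0 = (i, j)" by force
  have "pending s0 = pending s" by (simp add: s0_def)
  then have mem: "(i, j) \<in> pending s"
    using sched ij pend(2) unfolding schedule_def by metis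
  then have "(i, j) \<in> cluster_pairs \<Gamma>1 \<Gamma>2" "i < j"
    using pend(1) by blast+
  then obtain \<Gamma> where \<Gamma>: "\<Gamma> \<in> {\<Gamma>1, \<Gamma>2}" "i \<in> \<Gamma>" "j \<in> \<Gamma>"
    unfolding cluster_pairs_def by blast
  have visit: "distinct (visit s0 i j)" "set (visit s0 i j) = \<Gamma> - {i, j}"
    using sched \<Gamma> \<open>i < j\<close> unfolding schedule_def by metis+
  have "certify_body sel visit s = (let t = certify_k_loop i j (visit s0 i j) s0
      in if success t then t else t\<lparr>returned := True\<rparr>)"
    by (simp only: certify_body_def Let_def s0_def[symmetric] ij prod.case)
  then show thesis
    unfolding s0_def by (rule that[OF \<Gamma> \<open>i < j\<close> mem visit[unfolded s0_def]])
qed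

text \<open>Every round either removes a pending pair or returns; this is both the termination argument and the
  reason why \<open>pending\<close> is empty after a success.\<close>

lemma certify_body_effect:
  assumes sched: "schedule \<Gamma>1 \<Gamma>2 sel visit" and fin: "finite \<Gamma>1" "finite \<Gamma>2"
    and card: "card \<Gamma>1 \<le> n" "card \<Gamma>2 \<le> n"
    and pend: "pending s \<subseteq> {(i, j) \<in> cluster_pairs \<Gamma>1 \<Gamma>2. i < j}" "pending s \<noteq> {}"
    and "\<not> returned s"
  defines "s' \<equiv> certify_body sel visit s"
  shows "ops s' \<le> ops s + (12 + 22 * n)" "returned s' \<longleftrightarrow> \<not> success s'"
    "\<exists>p\<in>pending s. pending s' = (if returned s' then pending s else pending s - {p})"
proof -
  obtain \<Gamma> i j ks where \<Gamma>: "\<Gamma> \<in> {\<Gamma>1, \<Gamma>2}" and mem: "(i, j) \<in> pending s"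
    and ks: "distinct ks" "set ks = \<Gamma> - {i, j}"
    and body: "certify_body sel visit s = (let t = certify_k_loop i j ks (tick 12 (s\<lparr>success := False\<rparr>))
           in if success t then t else t\<lparr>returned := True\<rparr>)"
    using certify_body_round[OF sched pend] by metis
  have "length ks = card (\<Gamma> - {i, j})"
    using ks distinct_card by metis
  also have "\<dots> \<le> card \<Gamma>"
    using \<Gamma> fin by (intro card_mono) auto
  also have "\<dots> \<le> n" using \<Gamma> card by auto
  finally have len: "length ks \<le> n" .
  define t where "t = certify_k_loop i j ks (tick 12 (s\<lparr>success := False\<rparr>))"
  have t: "ops t \<le> ops s + 12 + 22 * length ks" "\<not> returned t"
    "pending t = (if success t then pending s - {(i, j)} else pending s)"
    using certify_k_loop_effect[of "tick 12 (s\<lparr>success := False\<rparr>)" i j ks] \<open>\<not> returned s\<close>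
    by (simp_all add: t_def)
  have s': "s' = (if success t then t else t\<lparr>returned := True\<rparr>)"
    unfolding s'_def body Let_def t_def ..
  show "ops s' \<le> ops s + (12 + 22 * n)"
    using t(1) len s' by simp
  show "returned s' \<longleftrightarrow> \<not> success s'"
    using s' t(2) by simp
  show "\<exists>p\<in>pending s. pending s' = (if returned s' then pending s else pending s - {p})"
    using mem by (rule bexI[rotated]) (use s' t(2,3) in simp)
qed

lemma certifying_certify_body:
  assumes sched: "schedule \<Gamma>1 \<Gamma>2 sel visit" and fin: "finite \<Gamma>1" "finite \<Gamma>2"
    and inv: "certifying \<Gamma>1 \<Gamma>2 \<rho> c s" and "pending s \<noteq> {}"
    and comm: "\<And>i j. \<rho> i j = \<rho> j i"
    and tri: "\<And>\<Gamma> i j k. \<Gamma> \<in> {\<Gamma>1, \<Gamma>2} \<Longrightarrow> i \<in> \<Gamma> \<Longrightarrow> j \<in> \<Gamma> \<Longrightarrow> k \<in> \<Gamma> - {i, j} \<Longrightarrow> i < j \<Longrightarrow> \<rho> i j \<le> \<rho> i k + \<rho> k j"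
  shows "certifying \<Gamma>1 \<Gamma>2 \<rho> c (certify_body sel visit s)"
proof -
  have pend: "pending s \<subseteq> {(i, j) \<in> cluster_pairs \<Gamma>1 \<Gamma>2. i < j}"
    using inv unfolding certifying_def by blast
  obtain \<Gamma> i j ks where \<Gamma>: "\<Gamma> \<in> {\<Gamma>1, \<Gamma>2}" "i \<in> \<Gamma>" "j \<in> \<Gamma>" "i < j"
    and ks: "set ks = \<Gamma> - {i, j}"
    and body: "certify_body sel visit s = (let t = certify_k_loop i j ks (tick 12 (s\<lparr>success := False\<rparr>))
           in if success t then t else t\<lparr>returned := True\<rparr>)"
    using certify_body_round[OF sched pend \<open>pending s \<noteq> {}\<close>] by metis
  have "certifying \<Gamma>1 \<Gamma>2 \<rho> c (tick 12 (s\<lparr>success := False\<rparr>))"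
    using inv unfolding certifying_def by simp
  then have "certifying \<Gamma>1 \<Gamma>2 \<rho> c (certify_k_loop i j ks (tick 12 (s\<lparr>success := False\<rparr>)))"
    by (rule certifying_certify_k_loop[OF _ fin \<Gamma> equalityD1[OF ks] comm tri[OF \<Gamma>(1-3) _ \<Gamma>(4)]])
  moreover have "certifying \<Gamma>1 \<Gamma>2 \<rho> c (t\<lparr>returned := True\<rparr>) = certifying \<Gamma>1 \<Gamma>2 \<rho> c t" for t
    unfolding certifying_def by simp
  ultimately show ?thesis
    unfolding body Let_def by presburger
qed

section \<open>Initialization\<close>

lemma ops_fold:
  assumes "\<And>x s. ops (f x s) = ops s + c"
  shows "ops (fold f xs s) = ops s + c * length xs"
  using assms by (induction xs arbitrary: s) simp_all

lemma init_lam_effect: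
  assumes "finite \<Gamma>"
  shows "ops (init_lam \<Gamma> s) = ops s + 5 * card \<Gamma> ^ 3" "pending (init_lam \<Gamma> s) = pending s"
    "returned (init_lam \<Gamma> s) = returned s"
proof -
  define L where "L = List.product (sorted_list_of_set \<Gamma>) (List.product (sorted_list_of_set \<Gamma>) (sorted_list_of_set \<Gamma>))"
  define f where "f = (\<lambda>(i, j, k) s. tick 5 (if distinct [i, j, k] then s\<lparr>lam := (lam s)((i, j, k) := 0)\<rparr> else s))"
  have eq: "init_lam \<Gamma> s = fold f L s"
    by (simp only: init_lam_def Let_def L_def f_def)
  show "ops (init_lam \<Gamma> s) = ops s + 5 * card \<Gamma> ^ 3"
    unfolding eq by (subst ops_fold[where c = 5])
      (auto simp: f_def L_def length_product power3_eq_cube)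
  have "pending (fold f xs s) = pending s \<and> returned (fold f xs s) = returned s" for xs
    by (induction xs arbitrary: s) (auto simp: f_def split: if_splits)
  then show "pending (init_lam \<Gamma> s) = pending s" "returned (init_lam \<Gamma> s) = returned s"
    unfolding eq by simp_all
qed

lemma init_rbar_effect:
  assumes "finite \<Gamma>"
  shows "ops (init_rbar g \<Gamma> s) = ops s + 3 * card \<Gamma> ^ 2" "pending (init_rbar g \<Gamma> s) = pending s"
    "returned (init_rbar g \<Gamma> s) = returned s"
    "i < j \<Longrightarrow> rbar (init_rbar g \<Gamma> s) {i, j} = (if i \<in> \<Gamma> \<and> j \<in> \<Gamma> then g i j else rbar s {i, j})"
proof -
  define L where "L = List.product (sorted_list_of_set \<Gamma>) (sorted_list_of_set \<Gamma>)"
  define f where "f = (\<lambda>(i, j) s. tick 3 (if i < j then s\<lparr>rbar := (rbar s)({i, j} := g i j)\<rparr> else s))"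
  have eq: "init_rbar g \<Gamma> s = fold f L s"
    by (simp only: init_rbar_def Let_def L_def f_def)
  show "ops (init_rbar g \<Gamma> s) = ops s + 3 * card \<Gamma> ^ 2"
    unfolding eq by (subst ops_fold[where c = 3])
      (auto simp: f_def L_def length_product power2_eq_square)
  have "pending (fold f xs s) = pending s \<and> returned (fold f xs s) = returned s" for xs
    by (induction xs arbitrary: s) (auto simp: f_def split: if_splits)
  then show "pending (init_rbar g \<Gamma> s) = pending s" "returned (init_rbar g \<Gamma> s) = returned s"
    unfolding eq by simp_all
  assume "i < j"
  have "rbar (fold f xs s) {i, j} = (if (i, j) \<in> set xs then g i j else rbar s {i, j})" for xs
  proof (induction xs rule: rev_induct)
    case (snoc p xs)
    obtain a b where p: "p = (a, b)" by force
    have step: "rbar (f p t) = (if a < b then (rbar t)({a, b} := g a b) else rbar t)" for t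
      by (simp add: f_def p)
    show ?case
    proof (cases "(i, j) = p")
      case True
      then show ?thesis using \<open>i < j\<close> by (simp add: f_def p)
    next
      case False
      have "rbar (f p t) {i, j} = rbar t {i, j}" for t
      proof (cases "a < b")
        case True
        then have "{i, j} \<noteq> {a, b}"
          using False \<open>i < j\<close> unfolding p doubleton_eq_iff by simp
        then show ?thesis
          unfolding step if_P[OF True] by (rule fun_upd_other)
      qed (simp add: step)
      then show ?thesis using False snoc.IH by simp
    qed
  qed simp
  then show "rbar (init_rbar g \<Gamma> s) {i, j} = (if i \<in> \<Gamma> \<and> j \<in> \<Gamma> then g i j else rbar s {i, j})"
    unfolding eq using assms by (simp add: L_def set_product)
qed

lemma init_pending_effect:
  assumes "finite \<Gamma>"
  shows "ops (init_pending \<Gamma> s) = ops s + 4 * card \<Gamma> ^ 2" "rbar (init_pending \<Gamma> s) = rbar s"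
    "returned (init_pending \<Gamma> s) = returned s"
    "pending (init_pending \<Gamma> s) = pending s \<union> {(i, j) \<in> \<Gamma> \<times> \<Gamma>. i < j \<and> rbar s {i, j} < 0}"
proof -
  define L where "L = List.product (sorted_list_of_set \<Gamma>) (sorted_list_of_set \<Gamma>)"
  define f where "f = (\<lambda>(i, j) s. tick 4
    (if i < j \<and> rbar s {i, j} < 0 then s\<lparr>pending := insert (i, j) (pending s)\<rparr> else s))"
  have eq: "init_pending \<Gamma> s = fold f L s"
    by (simp only: init_pending_def Let_def L_def f_def)
  show "ops (init_pending \<Gamma> s) = ops s + 4 * card \<Gamma> ^ 2"
    unfolding eq by (subst ops_fold[where c = 4])
      (auto simp: f_def L_def length_product power2_eq_square)
  have *: "rbar (fold f xs s) = rbar s \<and> returned (fold f xs s) = returned s \<and>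
      pending (fold f xs s) = pending s \<union> {(i, j) \<in> set xs. i < j \<and> rbar s {i, j} < 0}" for xs
  proof (induction xs rule: rev_induct)
    case (snoc p xs)
    obtain i j where "p = (i, j)" by force
    then show ?case
      using snoc by (cases "i < j \<and> rbar s {i, j} < 0") (auto simp: f_def)
  qed simp
  then show "rbar (init_pending \<Gamma> s) = rbar s" "returned (init_pending \<Gamma> s) = returned s"
    unfolding eq by simp_all
  show "pending (init_pending \<Gamma> s) = pending s \<union> {(i, j) \<in> \<Gamma> \<times> \<Gamma>. i < j \<and> rbar s {i, j} < 0}"
    unfolding eq using * assms by (simp add: L_def set_product)
qed

lemma certify_init_effect:
  fixes \<Gamma>1 \<Gamma>2 :: "nat set" and g :: "nat \<Rightarrow> nat \<Rightarrow> real"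
  assumes fin: "finite \<Gamma>1" "finite \<Gamma>2"
  defines "s \<equiv> certify_init \<Gamma>1 \<Gamma>2 g"
  shows "ops s = 5 * (card \<Gamma>1 ^ 3 + card \<Gamma>2 ^ 3) + 7 * (card \<Gamma>1 ^ 2 + card \<Gamma>2 ^ 2) + 4"
    and "\<not> returned s"
    and "(i, j) \<in> cluster_pairs \<Gamma>1 \<Gamma>2 \<Longrightarrow> i < j \<Longrightarrow> rbar s {i, j} = g i j"
    and "pending s = {(i, j) \<in> cluster_pairs \<Gamma>1 \<Gamma>2. i < j \<and> g i j < 0}"
proof -
  define t where "t = init_lam \<Gamma>2 (init_lam \<Gamma>1 blank_state)"
  define u where "u = init_rbar g \<Gamma>2 (init_rbar g \<Gamma>1 t)"
  define v where "v = init_pending \<Gamma>2 (init_pending \<Gamma>1 u)"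
  have s: "s = tick 4 (if pending v = {} then v\<lparr>success := True\<rparr> else v)"
    by (simp add: s_def certify_init_def Let_def t_def u_def v_def)
  show "ops s = 5 * (card \<Gamma>1 ^ 3 + card \<Gamma>2 ^ 3) + 7 * (card \<Gamma>1 ^ 2 + card \<Gamma>2 ^ 2) + 4"
    using fin by (simp add: s v_def u_def t_def init_lam_effect init_rbar_effect init_pending_effect blank_state_def)
  show "\<not> returned s"
    using fin by (simp add: s v_def u_def t_def init_lam_effect init_rbar_effect init_pending_effect blank_state_def)
  have rbar_u: "rbar u {i, j} = g i j" if "(i, j) \<in> cluster_pairs \<Gamma>1 \<Gamma>2" "i < j" for i j
    using that fin by (auto simp: u_def init_rbar_effect cluster_pairs_def)
  then show "(i, j) \<in> cluster_pairs \<Gamma>1 \<Gamma>2 \<Longrightarrow> i < j \<Longrightarrow> rbar s {i, j} = g i j"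
    using fin by (simp add: s v_def init_pending_effect)
  have "pending u = {}"
    using fin by (simp add: u_def t_def init_lam_effect init_rbar_effect blank_state_def)
  then have "pending s = {(i, j) \<in> cluster_pairs \<Gamma>1 \<Gamma>2. i < j \<and> rbar u {i, j} < 0}"
    using fin by (auto simp: s v_def init_pending_effect cluster_pairs_def)
  then show "pending s = {(i, j) \<in> cluster_pairs \<Gamma>1 \<Gamma>2. i < j \<and> g i j < 0}"
    using rbar_u by auto
qed

section \<open>What a run of the algorithm shows and costs\<close>

text \<open>A successful run rewrites \<open>g\<close>, up to nonnegative multiples of triangle inequalities, into
  nonnegative weights.\<close>

lemma certify_success_imp_nonneg:
  assumes fin: "finite \<Gamma>1" "finite \<Gamma>2"
    and sched: "schedule \<Gamma>1 \<Gamma>2 sel visit"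
    and run: "certify \<Gamma>1 \<Gamma>2 g sel visit = Some s" "success s"
    and g: "\<And>i j. g i j = g j i"
    and \<rho>: "\<And>i j. \<rho> i j = \<rho> j i" "\<And>i. \<rho> i i = 0"
    and nonneg: "\<And>i j. (i, j) \<in> cluster_pairs \<Gamma>1 \<Gamma>2 \<Longrightarrow> 0 \<le> \<rho> i j"
    and tri: "\<And>\<Gamma> i j k. \<Gamma> \<in> {\<Gamma>1, \<Gamma>2} \<Longrightarrow> i \<in> \<Gamma> \<Longrightarrow> j \<in> \<Gamma> \<Longrightarrow> k \<in> \<Gamma> - {i, j} \<Longrightarrow> i < j \<Longrightarrow> \<rho> i j \<le> \<rho> i k + \<rho> k j"
  shows "0 \<le> (\<Sum>(i, j)\<in>cluster_pairs \<Gamma>1 \<Gamma>2. g i j * \<rho> i j)"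
proof -
  let ?P = "cluster_pairs \<Gamma>1 \<Gamma>2"
  define c where "c = (\<Sum>(i, j)\<in>?P. g i j * \<rho> i j)"
  define s0 where "s0 = certify_init \<Gamma>1 \<Gamma>2 g"
  note init = certify_init_effect[OF fin, where g = g, folded s0_def]
  \<comment> \<open>On the diagonal \<open>rbar\<close> is uninitialized memory, but there \<open>\<rho>\<close> vanishes.\<close>
  have "rbar s0 {i, j} * \<rho> i j = g i j * \<rho> i j" if "(i, j) \<in> ?P" for i j
  proof (cases i j rule: linorder_cases)
    case less
    then show ?thesis using init(3) that by simp
  next
    case greater
    have "(j, i) \<in> ?P" using that by (auto simp: cluster_pairs_def)
    then show ?thesis using init(3)[of j i] greater g by (simp add: insert_commute)
  qed (simp add: \<rho>(2))
  then have "(\<Sum>(i, j)\<in>?P. rbar s0 {i, j} * \<rho> i j) = c"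
    unfolding c_def by (intro sum.cong refl) auto
  then have "certifying \<Gamma>1 \<Gamma>2 \<rho> c s0"
    using init(3,4) by (auto simp: certifying_def)
  moreover have "certifying \<Gamma>1 \<Gamma>2 \<rho> c (certify_body sel visit t) \<and>
      (returned (certify_body sel visit t) \<longrightarrow> \<not> success (certify_body sel visit t))"
    if "certifying \<Gamma>1 \<Gamma>2 \<rho> c t" "pending t \<noteq> {}" "\<not> returned t" for t
    using certifying_certify_body[OF sched fin that(1,2) \<rho>(1) tri]
      certify_body_effect(2)[OF sched fin, of "card \<Gamma>1 + card \<Gamma>2" t] that
    by (auto simp: certifying_def)
  ultimately have "certifying \<Gamma>1 \<Gamma>2 \<rho> c s \<and> (returned s \<longrightarrow> \<not> success s)"
    using run(1) init(2) unfolding certify_def s0_def[symmetric]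
    by (elim while_option_rule[where P = "\<lambda>s. certifying \<Gamma>1 \<Gamma>2 \<rho> c s \<and> (returned s \<longrightarrow> \<not> success s)", rotated]) auto
  moreover have "pending s = {} \<or> returned s"
    using while_option_stop[OF run(1)[unfolded certify_def]] by blast
  ultimately have inv: "certifying \<Gamma>1 \<Gamma>2 \<rho> c s" "pending s = {}"
    using run(2) by auto
  have "0 \<le> rbar s {i, j} * \<rho> i j" if "(i, j) \<in> ?P" for i j
  proof -
    have ge: "0 \<le> rbar s {p, q}" if "(p, q) \<in> ?P" "p < q" for p q
      using inv that unfolding certifying_def by (metis (no_types, lifting) case_prodD empty_iff not_le)
    have "(j, i) \<in> ?P" using that by (auto simp: cluster_pairs_def)
    then have "i \<noteq> j \<Longrightarrow> 0 \<le> rbar s {i, j}"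
      using ge[of i j] ge[of j i] that by (metis insert_commute linorder_neqE_nat)
    then show ?thesis
      using nonneg[OF that] \<rho>(2) by (cases "i = j") auto
  qed
  then have "0 \<le> (\<Sum>(i, j)\<in>?P. rbar s {i, j} * \<rho> i j)"
    by (intro sum_nonneg) auto
  also have "\<dots> \<le> c"
    using inv(1) unfolding certifying_def by blast
  finally show ?thesis unfolding c_def .
qed

text \<open>The amortized quantity \<open>ops s + C * rounds s\<close> does not increase, where \<open>C\<close> bounds the cost of one
  round and \<open>rounds s\<close> the number of rounds that may follow. Initially it is at most
  \<open>10 * n\<^sup>3 + 14 * n\<^sup>2 + 4\<close> for the initialization plus \<open>n\<^sup>2 * (12 + 22 * n)\<close> for the
  rounds, and \<open>10 + 14 + 4 + 12 + 22 = 62\<close>.\<close>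

lemma certify_ops_le:
  assumes part: "bipartition n \<Gamma>1 \<Gamma>2" and sched: "schedule \<Gamma>1 \<Gamma>2 sel visit"
  shows "\<exists>s. certify \<Gamma>1 \<Gamma>2 g sel visit = Some s \<and> ops s \<le> 62 * n ^ 3"
proof -
  have un: "\<Gamma>1 \<union> \<Gamma>2 = {1..n}" and ne: "\<Gamma>1 \<noteq> {}"
    using part unfolding bipartition_def by blast+
  have fin: "finite \<Gamma>1" "finite \<Gamma>2"
    using un by (metis finite_Un finite_atLeastAtMost)+
  have card: "card \<Gamma>1 \<le> n" "card \<Gamma>2 \<le> n"
    using un card_mono[of "{1..n}"] by (metis Un_upper1 Un_upper2 card_atLeastAtMost diff_Suc_1 finite_atLeastAtMost)+
  have "n \<ge> 1" using un ne by (cases n) auto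
  let ?P = "cluster_pairs \<Gamma>1 \<Gamma>2"
  define s0 where "s0 = certify_init \<Gamma>1 \<Gamma>2 g"
  note init = certify_init_effect[OF fin, where g = g, folded s0_def]
  define C where "C = 12 + 22 * n"
  define rounds where "rounds s = (if returned s then 0 else card (pending s))" for s :: cert_state
  define I where "I s \<longleftrightarrow> pending s \<subseteq> {(i, j) \<in> ?P. i < j} \<and> ops s + C * rounds s \<le> 62 * n ^ 3" for s :: cert_state
  have finP: "finite {(i, j) \<in> ?P. i < j}"
    using fin by (auto intro: finite_subset[of _ ?P] simp: cluster_pairs_def)
  have step: "I (certify_body sel visit s) \<and> rounds (certify_body sel visit s) < rounds s"
    if s: "I s" "pending s \<noteq> {} \<and> \<not> returned s" for s
  proof -
    define t where "t = certify_body sel visit s"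
    have sub: "pending s \<subseteq> {(i, j) \<in> ?P. i < j}" using s(1) by (simp add: I_def)
    have t: "ops t \<le> ops s + C" "\<exists>p\<in>pending s. pending t = (if returned t then pending s else pending s - {p})"
      using certify_body_effect[OF sched fin card sub] s(2) by (auto simp: t_def C_def)
    have finS: "finite (pending s)" using sub finP by (rule finite_subset)
    then have "card (pending s) > 0" using s(2) by (simp add: card_gt_0_iff)
    then have lt: "rounds t < rounds s"
      using t(2) s(2) finS by (auto simp: rounds_def card_Diff_singleton)
    then have "C + C * rounds t \<le> C * rounds s"
      using mult_le_mono2[of "Suc (rounds t)" "rounds s" C] by simp
    then have "I t"
      using t s(1) sub unfolding I_def by (auto split: if_splits)
    then show ?thesis using lt by (simp add: t_def)
  qed
  have "I s0"
  proof -
    have "pending s0 \<subseteq> {1..n} \<times> {1..n}"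
      using init(4) un by (auto simp: cluster_pairs_def)
    then have "card (pending s0) \<le> n * n"
      using card_mono[of "{1..n} \<times> {1..n}" "pending s0"] by simp
    then have "C * rounds s0 \<le> C * (n * n)"
      by (intro mult_le_mono2) (simp add: rounds_def)
    also have "\<dots> = 12 * n ^ 2 + 22 * n ^ 3"
      by (simp add: C_def power2_eq_square power3_eq_cube algebra_simps)
    finally have "C * rounds s0 \<le> 12 * n ^ 2 + 22 * n ^ 3" .
    moreover have "card \<Gamma>1 ^ 3 \<le> n ^ 3" "card \<Gamma>2 ^ 3 \<le> n ^ 3" "card \<Gamma>1 ^ 2 \<le> n ^ 3" "card \<Gamma>2 ^ 2 \<le> n ^ 3"
        "n ^ 2 \<le> n ^ 3" "1 \<le> n ^ 3"
      using card \<open>n \<ge> 1\<close>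
      by (auto intro: power_mono order_trans[OF power_mono[of _ n 2] power_increasing[of 2 3 n]] power_increasing)
    ultimately have "ops s0 + C * rounds s0 \<le> 62 * n ^ 3"
      unfolding init(1) distrib_left by linarith
    then show ?thesis
      using init(4) by (auto simp: I_def)
  qed
  then obtain s where s: "certify \<Gamma>1 \<Gamma>2 g sel visit = Some s"
    unfolding certify_def s0_def[symmetric]
    using measure_while_option_Some[of I "\<lambda>s. pending s \<noteq> {} \<and> \<not> returned s" "certify_body sel visit" rounds s0] step
    by blast
  have "I s"
    using while_option_rule[of I, OF _ s[unfolded certify_def s0_def[symmetric]] \<open>I s0\<close>] step by blast
  then show ?thesis using s by (auto simp: I_def)
qed

section \<open>Optimality and running time\<close>

theorem proposition5:
  shows "(\<forall>n (x :: nat \<Rightarrow> real ^ 'm) \<Gamma>1 \<Gamma>2 sel visit s.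
           bipartition n \<Gamma>1 \<Gamma>2 \<and> card \<Gamma>1 \<le> card \<Gamma>2 \<and>
           schedule \<Gamma>1 \<Gamma>2 sel visit \<and>
           certify \<Gamma>1 \<Gamma>2 (gamma (sq_dist x) \<Gamma>1 \<Gamma>2) sel visit = Some s \<and> success s
           \<longrightarrow> lp2_optimal n (sq_dist x) (partition_matrix \<Gamma>1 \<Gamma>2)) \<and>
         (\<exists>T :: nat \<Rightarrow> nat. (\<lambda>n. real (T n)) \<in> O(\<lambda>n. real n ^ 3) \<and>
           (\<forall>n \<Gamma>1 \<Gamma>2 (g :: nat \<Rightarrow> nat \<Rightarrow> real) sel visit.
             bipartition n \<Gamma>1 \<Gamma>2 \<and> card \<Gamma>1 \<le> card \<Gamma>2 \<and> schedule \<Gamma>1 \<Gamma>2 sel visit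
             \<longrightarrow> (\<exists>s. certify \<Gamma>1 \<Gamma>2 g sel visit = Some s \<and> ops s \<le> T n)))"
proof (intro conjI allI impI; (elim conjE)?)
  fix n and x :: "nat \<Rightarrow> real ^ 'm" and \<Gamma>1 \<Gamma>2 sel visit s
  assume part: "bipartition n \<Gamma>1 \<Gamma>2" and le: "card \<Gamma>1 \<le> card \<Gamma>2" and sched: "schedule \<Gamma>1 \<Gamma>2 sel visit"
    and run: "certify \<Gamma>1 \<Gamma>2 (gamma (sq_dist x) \<Gamma>1 \<Gamma>2) sel visit = Some s" "success s"
  let ?d = "sq_dist x" let ?g = "gamma ?d \<Gamma>1 \<Gamma>2"
  have sym: "?d i j = ?d j i" for i j
    by (simp add: sq_dist_def norm_minus_commute)
  have ne: "\<Gamma>1 \<noteq> {}" "\<Gamma>2 \<noteq> {}" and un: "\<Gamma>1 \<union> \<Gamma>2 = {1..n}" and dis: "\<Gamma>1 \<inter> \<Gamma>2 = {}"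
    using part unfolding bipartition_def by auto
  have fin: "finite \<Gamma>1" "finite \<Gamma>2"
    using un by (metis finite_Un finite_atLeastAtMost)+
  have "lp2_objective n ?d (partition_matrix \<Gamma>1 \<Gamma>2) \<le> lp2_objective n ?d X" if X: "lp2_feasible n X" for X
  proof -
    have "?g i j = ?g j i" for i j
      by (cases i j rule: linorder_cases) (simp_all add: gamma_def)
    moreover have "0 \<le> gap X i j" if pair: "(i, j) \<in> cluster_pairs \<Gamma>1 \<Gamma>2" for i j
    proof -
      have mem: "i \<in> {1..n}" "j \<in> {1..n}" using pair un by (auto simp: cluster_pairs_def)
      \<comment> \<open>The third point is taken from the other cluster.\<close>
      have "\<exists>k\<in>{1..n}. k \<noteq> i \<and> k \<noteq> j"
      proof (cases "i \<in> \<Gamma>1")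
        case True
        obtain k where "k \<in> \<Gamma>2" using ne(2) by blast
        moreover have "i \<notin> \<Gamma>2" "j \<notin> \<Gamma>2"
          using True pair dis by (auto simp: cluster_pairs_def)
        ultimately show ?thesis using un by (metis UnI2)
      next
        case False
        obtain k where "k \<in> \<Gamma>1" using ne(1) by blast
        moreover have "j \<notin> \<Gamma>1"
          using False pair dis by (auto simp: cluster_pairs_def)
        ultimately show ?thesis using un False by (metis UnI1)
      qed
      then obtain k where "k \<in> {1..n}" "k \<noteq> i" "k \<noteq> j" by blast
      then show ?thesis using gap_nonneg[OF X mem] by simp
    qed
    moreover have "gap X i j \<le> gap X i k + gap X k j"
      if "\<Gamma> \<in> {\<Gamma>1, \<Gamma>2}" "i \<in> \<Gamma>" "j \<in> \<Gamma>" "k \<in> \<Gamma> - {i, j}" "i < j" for \<Gamma> i j k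
      using that un by (intro gap_triangle[OF X]) auto
    ultimately have "0 \<le> (\<Sum>(i, j)\<in>cluster_pairs \<Gamma>1 \<Gamma>2. ?g i j * gap X i j)"
      by (intro certify_success_imp_nonneg[OF fin sched run] gap_commute gap_self)
    also have "\<dots> = (\<Sum>i\<in>\<Gamma>1. \<Sum>j\<in>\<Gamma>1. ?g i j * gap X i j) + (\<Sum>i\<in>\<Gamma>2. \<Sum>j\<in>\<Gamma>2. ?g i j * gap X i j)"
      unfolding cluster_pairs_def sum.cartesian_product using fin dis by (intro sum.union_disjoint) auto
    finally have "0 \<le> ((\<Sum>i\<in>\<Gamma>1. \<Sum>j\<in>\<Gamma>1. ?g i j * gap X i j)
        + (\<Sum>i\<in>\<Gamma>2. \<Sum>j\<in>\<Gamma>2. ?g i j * gap X i j)) / 2"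
      by simp
    also have "\<dots> \<le> lp2_objective n ?d X - ((\<Sum>i\<in>\<Gamma>1. d_in ?d \<Gamma>1 i) + (\<Sum>i\<in>\<Gamma>2. d_in ?d \<Gamma>2 i))"
      by (rule gamma_gap_sum_le[OF part le sym X])
    finally show ?thesis
      unfolding partition_matrix_objective[OF part] by simp
  qed
  then show "lp2_optimal n ?d (partition_matrix \<Gamma>1 \<Gamma>2)"
    using partition_matrix_feasible[OF part] by (auto simp: lp2_optimal_def is_arg_min_def not_less)
next
  have "(\<lambda>n. real (62 * n ^ 3)) \<in> O(\<lambda>n. real n ^ 3)"
    by simp
  then show "\<exists>T :: nat \<Rightarrow> nat. (\<lambda>n. real (T n)) \<in> O(\<lambda>n. real n ^ 3) \<and>
           (\<forall>n \<Gamma>1 \<Gamma>2 (g :: nat \<Rightarrow> nat \<Rightarrow> real) sel visit.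
             bipartition n \<Gamma>1 \<Gamma>2 \<and> card \<Gamma>1 \<le> card \<Gamma>2 \<and> schedule \<Gamma>1 \<Gamma>2 sel visit
             \<longrightarrow> (\<exists>s. certify \<Gamma>1 \<Gamma>2 g sel visit = Some s \<and> ops s \<le> T n))"
    using certify_ops_le by (intro exI[of _ "\<lambda>n. 62 * n ^ 3"]) blast
qed

end
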